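(* Let $\alpha\in\{-1,0,1\}$. There exists a positive constant $C_s$, independent of $h$ and $r$, such that for all $\boldsymbol w\in V_h$, $$B_h(\boldsymbol w,\boldsymbol w)\ge C_s\,|||\boldsymbol w|||^2 .$$
   Context: Setting. $\Omega\subset\mathbb R^n$ ($n=2$ or $3$) is a convex polygonal (polyhedral) domain with $\partial\Omega=\Gamma_D\cup\Gamma_N$ and unit outward normal $\boldsymbol n$. $\boldsymbol\epsilon(\boldsymbol u)=\frac12(\nabla\boldsymbol u+\nabla\boldsymbol u^T)$ and the stress is $\boldsymbol\sigma(\boldsymbol u)=\lambda(\nabla\cdot\boldsymbol u)\mathcal I+2\hat\mu\,\boldsymbol\epsilon(\boldsymbol u)$ (Lamé parameters $\lambda,\hat\mu$; $\mathcal I$ the identity), also written $\sigma_{ij}=C_{ijkl}\epsilon_{kl}(\boldsymbol u)$ (summation convention), where the fourth-order tensor $\boldsymbol C=(C_{ijkl})$ satisfies $C_{ijkl}=C_{jikl}=C_{ijlk}=C_{klij}$, is positive definite on symmetric matrices, and is piecewise constant in $\Omega$ (constant on each mesh element). Mesh and spaces. $\mathcal T_h$ is a member of a family of nondegenerate quasiuniform subdivisions of $\Omega$ into elements $K$, $h_K=\mathrm{diam}(K)$, $h=\max_K h_K$. $\Gamma_h$ denotes the (set of) interior edges (faces if $n=3$); $e$ denotes an edge/face, and $e\in\Gamma_h\cup\Gamma_D$ means that $e$ is an interior edge or an edge on $\Gamma_D$. $V_h=\{\boldsymbol v:\boldsymbol v|_K\in(\mathbb P_r(K))^n\ \forall K\in\mathcal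 T_h\}$, where $\mathbb P_r(K)$ is the space of polynomials of degree at most $r$, $r\ge1$. Averages and jumps. On an interior edge $e=\partial K^+\cap\partial K^-$ with fixed unit normal $\boldsymbol n$ pointing from $K^+$ to $K^-$ and traces $\boldsymbol v^\pm$ from $K^\pm$: $\{\boldsymbol v\}=(\boldsymbol v^++\boldsymbol v^-)/2$, $[\boldsymbol v]=\boldsymbol v^+-\boldsymbol v^-$. On a boundary edge $\{\boldsymbol v\}=[\boldsymbol v]=\boldsymbol v^+$ (the trace from the element), with $\boldsymbol n$ the outward normal. Bilinear form. With stabilization parameters $\beta>0,\gamma\ge0$ (independent of $h$ and $r$) and $\alpha\in\{-1,0,1\}$, $$B_h(\boldsymbol w,\boldsymbol v)=\sum_{K}\int_K\boldsymbol\sigma(\boldsymbol w):\boldsymbol\epsilon(\boldsymbol v)\,dx-\sum_{e\in\Gamma_h\cup\Gamma_D}\int_e\{\boldsymbol\sigma(\boldsymbol w)\boldsymbol n\}\cdot[\boldsymbol v]\,d\ell+\alpha\sum_{e\in\Gamma_h\cup\Gamma_D}\int_e\{\boldsymbol\sigma(\boldsymbol v)\boldsymbol n\}\cdot[\boldsymbol w]\,d\ell$$ $$+\frac{\beta r^2}{h}\sum_{e\in\Gamma_h\cup\Gamma_D}\int_e[\boldsymbol w]\cdot[\boldsymbol v]\,d\ell+\frac{\gamma r^2}{h}\sum_{e\in\Gamma_h\cup\Gamma_D}\int_e[\boldsymbol n\cdot\boldsymbol w][\boldsymbol n\cdot\boldsymbol v]\,d\ell.$$ Energy norm. $|||\boldsymbol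 v|||^2=\sum_K\int_K\boldsymbol\sigma(\boldsymbol v):\boldsymbol\epsilon(\boldsymbol v)\,dx+\frac{\beta r^2}{h}\sum_{e\in\Gamma_h\cup\Gamma_D}\|[\boldsymbol v]\|_{0,e}^2+\frac{\gamma r^2}{h}\sum_{e\in\Gamma_h\cup\Gamma_D}\|[\boldsymbol n\cdot\boldsymbol v]\|_{0,e}^2$.
   Formalization: For α = -1 and α = 0 the claim fails for small β > 0, so it is proved for all β above a threshold β₀ independent of h, r and γ; for α = 1 it is proved for every β > 0. C_s may depend on β and γ. *)

theory Defs
  imports "HOL-Analysis.Analysis"
begin

section \<open>Linear elasticity\<close>

type_synonym 'n tensor4 = "'n \<Rightarrow> 'n \<Rightarrow> 'n \<Rightarrow> 'n \<Rightarrow> real"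

definition elasticity_tensor :: "('n::finite) tensor4 \<Rightarrow> bool" where
  "elasticity_tensor C \<longleftrightarrow>
     (\<forall>i j k l. C i j k l = C j i k l \<and> C i j k l = C i j l k \<and> C i j k l = C k l i j) \<and>
     (\<forall>M :: real^'n^'n. transpose M = M \<longrightarrow> M \<noteq> 0 \<longrightarrow>
        0 < (\<Sum>i\<in>UNIV. \<Sum>j\<in>UNIV. \<Sum>k\<in>UNIV. \<Sum>l\<in>UNIV. C i j k l * M $ i $ j * M $ k $ l))"

definition strain :: "(real^'n \<Rightarrow> real^'n) \<Rightarrow> real^'n \<Rightarrow> real^'n^'n" where
  "strain u x =
     (1/2) *\<^sub>R (jacobian u (at x) + transpose (jacobian u (at x)))"

definition stress ::
  "(real^'n \<Rightarrow> 'n tensor4) \<Rightarrow> (real^'n \<Rightarrow> real^'n) \<Rightarrow> real^'n \<Rightarrow> real^'n^'n" where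
  "stress C u x = (\<chi> i j. \<Sum>k\<in>UNIV. \<Sum>l\<in>UNIV. C x i j k l * strain u x $ k $ l)"

text \<open>The isotropic material with Lame parameters \<open>lam\<close> and \<open>mu\<close> is the special case
  below.\<close>

definition lame_tensor :: "real \<Rightarrow> real \<Rightarrow> 'n tensor4" where
  "lame_tensor lam mu i j k l =
     lam * (of_bool (i = j) * of_bool (k = l)) +
     mu * (of_bool (i = k) * of_bool (j = l) + of_bool (i = l) * of_bool (j = k))"

definition divergence :: "(real^'n \<Rightarrow> real^'n) \<Rightarrow> real^'n \<Rightarrow> real" where
  "divergence u x = trace (jacobian u (at x))"

lemma lame_tensor_apply:
  fixes M :: "real^'n^'n"
  assumes "transpose M = M"
  shows "(\<Sum>k\<in>UNIV. \<Sum>l\<in>UNIV. lame_tensor lam mu i j k l * M $ k $ l) =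
    lam * trace M * of_bool (i = j) + 2 * mu * M $ i $ j"
proof -
  have sym: "M $ j $ i = M $ i $ j"
    using assms by (metis transpose_def vec_lambda_beta)
  have d: "(\<Sum>l\<in>UNIV. of_bool (k = l) * M $ k $ l) = M $ k $ k" for k
    by (simp add: of_bool_def if_distrib[of "\<lambda>x. x * _"] cong: if_cong)
  have e: "(\<Sum>k\<in>UNIV. \<Sum>l\<in>UNIV. of_bool (p = k) * (of_bool (q = l) * M $ k $ l)) = M $ p $ q"
    for p q
  proof -
    have "(\<Sum>l\<in>UNIV. of_bool (q = l) * M $ k $ l) = M $ k $ q" for k
      by (simp add: of_bool_def if_distrib[of "\<lambda>x. x * _"] cong: if_cong)
    then show ?thesis
      unfolding sum_distrib_left[symmetric]
      by (simp add: of_bool_def if_distrib[of "\<lambda>x. x * _"] cong: if_cong)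
  qed
  have "(\<Sum>k\<in>UNIV. \<Sum>l\<in>UNIV. lame_tensor lam mu i j k l * M $ k $ l) =
     lam * of_bool (i = j) * (\<Sum>k\<in>UNIV. \<Sum>l\<in>UNIV. of_bool (k = l) * M $ k $ l)
     + mu * (\<Sum>k\<in>UNIV. \<Sum>l\<in>UNIV. of_bool (i = k) * (of_bool (j = l) * M $ k $ l))
     + mu * (\<Sum>k\<in>UNIV. \<Sum>l\<in>UNIV. of_bool (j = k) * (of_bool (i = l) * M $ k $ l))"
    unfolding lame_tensor_def sum_distrib_left sum.distrib[symmetric]
    by (intro sum.cong refl) (simp add: algebra_simps)
  also have "(\<Sum>k\<in>UNIV. \<Sum>l\<in>UNIV. of_bool (i = k) * (of_bool (j = l) * M $ k $ l)) = M $ i $ j"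
    by (rule e)
  also have "(\<Sum>k\<in>UNIV. \<Sum>l\<in>UNIV. of_bool (j = k) * (of_bool (i = l) * M $ k $ l)) = M $ j $ i"
    by (rule e)
  finally show ?thesis
    using sym by (simp add: d trace_def)
qed

lemma stress_lame_tensor:
  "stress (\<lambda>x. lame_tensor (lam x) (mu x)) u x =
     (lam x * divergence u x) *\<^sub>R mat 1 + (2 * mu x) *\<^sub>R strain u x"
proof -
  have s: "transpose (strain u x) = strain u x"
    by (simp add: strain_def transpose_def vec_eq_iff)
  have t: "trace (strain u x) = divergence u x"
    by (simp add: strain_def divergence_def trace_def transpose_def)
  show ?thesis
    by (simp add: vec_eq_iff stress_def lame_tensor_apply[OF s] t mat_def)
qed

lemma elasticity_tensor_lame_tensor:
  assumes "mu > 0" and "lam \<ge> 0"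
  shows "elasticity_tensor (lame_tensor lam mu :: ('n::finite) tensor4)"
proof -
  have "0 < (\<Sum>i\<in>UNIV. \<Sum>j\<in>UNIV. \<Sum>k\<in>UNIV. \<Sum>l\<in>UNIV.
           lame_tensor lam mu i j k l * M $ i $ j * M $ k $ l)"
    if M: "transpose M = M" "M \<noteq> 0" for M :: "real^'n^'n"
  proof -
    have "(\<Sum>k\<in>UNIV. \<Sum>l\<in>UNIV. lame_tensor lam mu i j k l * M $ i $ j * M $ k $ l) =
        (lam * trace M * of_bool (i = j) + 2 * mu * M $ i $ j) * M $ i $ j" for i j
      unfolding lame_tensor_apply[OF M(1), symmetric] sum_distrib_right
      by (intro sum.cong refl) (simp add: algebra_simps)
    then have "(\<Sum>i\<in>UNIV. \<Sum>j\<in>UNIV. \<Sum>k\<in>UNIV. \<Sum>l\<in>UNIV.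
           lame_tensor lam mu i j k l * M $ i $ j * M $ k $ l) =
        (\<Sum>i\<in>UNIV. \<Sum>j\<in>UNIV. lam * trace M * (of_bool (i = j) * M $ i $ j)
           + 2 * mu * (M $ i $ j * M $ i $ j))"
      by (simp add: algebra_simps)
    also have "\<dots> = lam * trace M * (\<Sum>i\<in>UNIV. \<Sum>j\<in>UNIV. of_bool (i = j) * M $ i $ j)
           + 2 * mu * (M \<bullet> M)"
      unfolding sum_distrib_left inner_vec_def inner_real_def sum.distrib ..
    also have "(\<Sum>i\<in>UNIV. \<Sum>j\<in>UNIV. of_bool (i = j) * M $ i $ j) = trace M"
      by (simp add: trace_def of_bool_def if_distrib[of "\<lambda>x. x * _"] cong: if_cong)
    finally have *: "(\<Sum>i\<in>UNIV. \<Sum>j\<in>UNIV. \<Sum>k\<in>UNIV. \<Sum>l\<in>UNIV.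
           lame_tensor lam mu i j k l * M $ i $ j * M $ k $ l) =
        lam * (trace M * trace M) + 2 * mu * (M \<bullet> M)"
      by (simp add: algebra_simps)
    have "0 < 2 * mu * (M \<bullet> M)" using assms(1) M(2) by simp
    moreover have "0 \<le> lam * (trace M * trace M)" using assms(2) by simp
    ultimately show ?thesis unfolding * by linarith
  qed
  then show ?thesis
    unfolding elasticity_tensor_def
    by (auto simp: lame_tensor_def mult_ac add_ac eq_commute)
qed


section \<open>Subdivisions\<close>

definition polytopal_domain :: "(real^'n) set \<Rightarrow> bool" where
  "polytopal_domain Om \<longleftrightarrow> open Om \<and> convex Om \<and> Om \<noteq> {} \<and> polytope (closure Om)"

definition subdivision :: "(real^'n) set \<Rightarrow> (real^'n) set set \<Rightarrow> bool" where
  "subdivision Om T \<longleftrightarrow> finite T \<and> \<Union>T = closure Om \<and>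
     (\<forall>K\<in>T. polytope K \<and> interior K \<noteq> {}) \<and>
     (\<forall>K\<in>T. \<forall>K'\<in>T. K \<noteq> K' \<longrightarrow> interior K \<inter> interior K' = {})"

definition mesh_size :: "(real^'n) set set \<Rightarrow> real" where
  "mesh_size T = Max (diameter ` T)"

text \<open>The elements are convex, hence star-shaped with respect to every ball they contain.\<close>

definition nondegenerate_family :: "(real^'n) set set set \<Rightarrow> bool" where
  "nondegenerate_family F \<longleftrightarrow>
     (\<exists>\<rho>>0. \<forall>T\<in>F. \<forall>K\<in>T. \<exists>x. cball x (\<rho> * diameter K) \<subseteq> K)"

definition quasiuniform_family :: "(real^'n) set set set \<Rightarrow> bool" where
  "quasiuniform_family F \<longleftrightarrow>
     (\<exists>\<rho>>0. \<forall>T\<in>F. \<forall>K\<in>T. \<rho> * mesh_size T \<le> diameter K)"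

definition interior_edges :: "(real^'n) set set \<Rightarrow> (real^'n) set set" where
  "interior_edges T = {frontier K \<inter> frontier K' | K K'. K \<in> T \<and> K' \<in> T \<and> K \<noteq> K' \<and>
     aff_dim (frontier K \<inter> frontier K') = int CARD('n) - 1}"

text \<open>Edges are closed sets; comparing their relative interiors with the Dirichlet part \<open>GD\<close>
  makes the definition independent of whether \<open>GD\<close> contains its relative boundary.\<close>

definition dirichlet_edges ::
  "(real^'n) set \<Rightarrow> (real^'n) set \<Rightarrow> (real^'n) set set \<Rightarrow> (real^'n) set set" where
  "dirichlet_edges Om GD T =
     {e. \<exists>K\<in>T. e facet_of K \<and> e \<subseteq> frontier Om \<and> rel_interior e \<subseteq> GD}"

definition dg_edges ::
  "(real^'n) set \<Rightarrow> (real^'n) set \<Rightarrow> (real^'n) set set \<Rightarrow> (real^'n) set set" where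
  "dg_edges Om GD T = interior_edges T \<union> dirichlet_edges Om GD T"

text \<open>An orientation \<open>P\<close> selects for every edge the element called $K^+$, on a boundary edge
  necessarily the only element adjacent to it.\<close>

definition orientation ::
  "(real^'n) set set \<Rightarrow> (real^'n) set set \<Rightarrow> ((real^'n) set \<Rightarrow> (real^'n) set) \<Rightarrow> bool" where
  "orientation T E P \<longleftrightarrow> (\<forall>e\<in>E. P e \<in> T \<and> e \<subseteq> frontier (P e))"

definition opposite ::
  "(real^'n) set set \<Rightarrow> ((real^'n) set \<Rightarrow> (real^'n) set) \<Rightarrow> (real^'n) set \<Rightarrow> (real^'n) set" where
  "opposite T P e = (THE K. K \<in> T \<and> K \<noteq> P e \<and> e \<subseteq> frontier K)"

definition outward_normal :: "(real^'n) set \<Rightarrow> (real^'n) set \<Rightarrow> real^'n" where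
  "outward_normal K e = (THE \<nu>. norm \<nu> = 1 \<and> (\<forall>x\<in>e. \<forall>y\<in>K. \<nu> \<bullet> (y - x) \<le> 0))"


section \<open>Surface integrals over flat sets\<close>

text \<open>The affine hull of an edge \<open>e\<close> is a hyperplane, so Lebesgue measure is the product of
  the surface measure on that hyperplane and of the length in the normal direction. Hence the
  surface integral over \<open>e\<close> is the volume integral, over the right prism of height one with
  cross section \<open>e\<close>, of the integrand extended constantly in the normal direction.\<close>

definition unit_prism :: "(real^'n) set \<Rightarrow> (real^'n) set" where
  "unit_prism e = {y. closest_point (affine hull e) y \<in> e \<and>
                      dist y (closest_point (affine hull e) y) \<le> 1/2}"

definition edge_integral :: "(real^'n) set \<Rightarrow> (real^'n \<Rightarrow> real) \<Rightarrow> real" where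
  "edge_integral e f = integral (unit_prism e) (\<lambda>y. f (closest_point (affine hull e) y))"


section \<open>Broken polynomial spaces, averages and jumps\<close>

definition polynomials :: "nat \<Rightarrow> (real^'n \<Rightarrow> real) set" where
  "polynomials r = {p. \<exists>c. p = (\<lambda>x. \<Sum>k | (\<Sum>i\<in>UNIV. k i) \<le> r. c k * (\<Prod>i\<in>UNIV. x $ i ^ k i))}"

text \<open>The values on the element boundaries, a null set, are irrelevant: traces are taken as
  limits from the interior.\<close>

definition dg_space :: "(real^'n) set set \<Rightarrow> nat \<Rightarrow> (real^'n \<Rightarrow> real^'n) set" where
  "dg_space T r = {v. \<forall>K\<in>T. \<exists>p. (\<forall>i. (\<lambda>x. p x $ i) \<in> polynomials r) \<and>
     (\<forall>x\<in>interior K. v x = p x)}"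

definition element_trace :: "(real^'n) set \<Rightarrow> (real^'n \<Rightarrow> 'b::t2_space) \<Rightarrow> real^'n \<Rightarrow> 'b" where
  "element_trace K f x = Lim (at x within interior K) f"

definition average ::
  "(real^'n) set set \<Rightarrow> ((real^'n) set \<Rightarrow> (real^'n) set) \<Rightarrow> (real^'n) set \<Rightarrow>
   (real^'n \<Rightarrow> 'b::real_normed_vector) \<Rightarrow> real^'n \<Rightarrow> 'b" where
  "average T P e f x =
     (if e \<in> interior_edges T
      then (1/2) *\<^sub>R (element_trace (P e) f x + element_trace (opposite T P e) f x)
      else element_trace (P e) f x)"

definition jump ::
  "(real^'n) set set \<Rightarrow> ((real^'n) set \<Rightarrow> (real^'n) set) \<Rightarrow> (real^'n) set \<Rightarrow>
   (real^'n \<Rightarrow> 'b::real_normed_vector) \<Rightarrow> real^'n \<Rightarrow> 'b" where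
  "jump T P e f x =
     (if e \<in> interior_edges T
      then element_trace (P e) f x - element_trace (opposite T P e) f x
      else element_trace (P e) f x)"


section \<open>Bilinear form and energy norm\<close>

text \<open>On matrices the inner product \<open>\<bullet>\<close> is the double contraction.\<close>

definition Bh ::
  "(real^'n) set \<Rightarrow> (real^'n) set \<Rightarrow> (real^'n \<Rightarrow> 'n tensor4) \<Rightarrow> real \<Rightarrow> real \<Rightarrow> real \<Rightarrow>
   (real^'n) set set \<Rightarrow> ((real^'n) set \<Rightarrow> (real^'n) set) \<Rightarrow> nat \<Rightarrow>
   (real^'n \<Rightarrow> real^'n) \<Rightarrow> (real^'n \<Rightarrow> real^'n) \<Rightarrow> real" where
  "Bh Om GD C \<alpha> \<beta> \<gamma> T P r w v =
     (let h = mesh_size T; E = dg_edges Om GD T; n = (\<lambda>e. outward_normal (P e) e) in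
       (\<Sum>K\<in>T. integral K (\<lambda>x. stress C w x \<bullet> strain v x))
       - (\<Sum>e\<in>E. edge_integral e
            (\<lambda>x. average T P e (\<lambda>y. stress C w y *v n e) x \<bullet> jump T P e v x))
       + \<alpha> * (\<Sum>e\<in>E. edge_integral e
            (\<lambda>x. average T P e (\<lambda>y. stress C v y *v n e) x \<bullet> jump T P e w x))
       + \<beta> * (real r)\<^sup>2 / h * (\<Sum>e\<in>E. edge_integral e
            (\<lambda>x. jump T P e w x \<bullet> jump T P e v x))
       + \<gamma> * (real r)\<^sup>2 / h * (\<Sum>e\<in>E. edge_integral e
            (\<lambda>x. jump T P e (\<lambda>y. n e \<bullet> w y) x * jump T P e (\<lambda>y. n e \<bullet> v y) x)))"

definition energy_norm ::
  "(real^'n) set \<Rightarrow> (real^'n) set \<Rightarrow> (real^'n \<Rightarrow> 'n tensor4) \<Rightarrow> real \<Rightarrow> real \<Rightarrow>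
   (real^'n) set set \<Rightarrow> ((real^'n) set \<Rightarrow> (real^'n) set) \<Rightarrow> nat \<Rightarrow>
   (real^'n \<Rightarrow> real^'n) \<Rightarrow> real" where
  "energy_norm Om GD C \<beta> \<gamma> T P r v =
     (let h = mesh_size T; E = dg_edges Om GD T; n = (\<lambda>e. outward_normal (P e) e) in
       sqrt ((\<Sum>K\<in>T. integral K (\<lambda>x. stress C v x \<bullet> strain v x))
       + \<beta> * (real r)\<^sup>2 / h * (\<Sum>e\<in>E. edge_integral e (\<lambda>x. (norm (jump T P e v x))\<^sup>2))
       + \<gamma> * (real r)\<^sup>2 / h * (\<Sum>e\<in>E. edge_integral e
            (\<lambda>x. (norm (jump T P e (\<lambda>y. n e \<bullet> v y) x))\<^sup>2))))"

end

theory Submission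
  imports Defs "HOL-Computational_Algebra.Polynomial"
begin

text \<open>For \<open>\<alpha> = 1\<close> the two consistency terms cancel and the form is the squared energy norm. Otherwise
  the consistency term is split by Young's inequality, and the stress part is absorbed into the
  volume energy with the help of the discrete trace inequality
  \<open>\<parallel>q\<parallel>\<^sub>0\<^sub>,\<^sub>e\<^sup>2 \<le> c r\<^sup>2 / h \<parallel>q\<parallel>\<^sup>2\<close> for polynomials of degree at most \<open>r\<close>, which leaves a
  condition on the size of \<open>\<beta>\<close>. For the trace inequality, the element is cut into the
  cones that join its edges to the centre of an inscribed ball; on each ray from the centre
  \<open>q\<close> is a polynomial in one variable, so everything follows from
  \<open>P(1)\<^sup>2 \<le> (r + 1) (r + n) \<integral>\<^sub>0\<^sup>1 t\<^sup>n\<^sup>-\<^sup>1 P(t)\<^sup>2 dt\<close>. The constants are uniform because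
  a single mesh shows that the material takes only finitely many values.\<close>

subsection \<open>Point values of polynomials at an endpoint\<close>

text \<open>The factor r^2 does not come from scaling to a reference element: (r + 1)(r + n) is the
  exact value at the endpoint of the polynomial that reproduces endpoint values in the weighted
  inner product, so the constant is explicit in the degree. The factor 1/h is the reciprocal height
  of a cone: the hyperplane of an edge does not enter the open inscribed ball, whose radius is at
  least a fixed multiple of h. Subdivisions may have hanging nodes, so an edge may be a proper part
  of a face of an element. The cones inside one element must nevertheless be disjoint, so that all
  its edges together are paid for by one integral over the element; much of the geometry serves to
  show that distinct edges have disjoint relative interiors. As a surface integral is defined by a
  prism, passing from an edge to its cone is a matter of Fubini's theorem and dilations of Lebesgue
  measure. The trace inequality is applied to the stress, whose square is at most a multiple of the
  energy density.\<close>

lemma prod_linear_factors: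
  fixes a :: "'b \<Rightarrow> 'a::idom"
  assumes "finite A"
  shows "degree (\<Prod>j\<in>A. [:a j, 1:]) = card A"
    and "coeff (\<Prod>j\<in>A. [:a j, 1:]) (card A) = 1"
    and "Suc k = card A \<Longrightarrow> coeff (\<Prod>j\<in>A. [:a j, 1:]) k = (\<Sum>j\<in>A. a j)"
proof -
  have deg: "degree (\<Prod>j\<in>B. [:a j, 1:]) = card B" if "finite B" for B
    using that by (subst degree_prod_eq_sum_degree) auto
  have lead: "coeff (\<Prod>j\<in>B. [:a j, 1:]) (card B) = 1" if "finite B" for B
    using lead_coeff_prod[of "\<lambda>j. [:a j, 1:]" B] deg[OF that] by simp
  show "degree (\<Prod>j\<in>A. [:a j, 1:]) = card A" "coeff (\<Prod>j\<in>A. [:a j, 1:]) (card A) = 1"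
    using deg lead assms by blast+
  show "coeff (\<Prod>j\<in>A. [:a j, 1:]) k = (\<Sum>j\<in>A. a j)" if "Suc k = card A"
    using assms that
  proof (induction A arbitrary: k rule: finite_induct)
    case (insert x B)
    show ?case
    proof (cases k)
      case 0
      then have "B = {}" using insert by auto
      then show ?thesis using 0 by simp
    next
      case (Suc l)
      have "card B = Suc l" using insert Suc by simp
      then show ?thesis
        using insert Suc lead[OF insert(1)] by simp
    qed
  qed simp
qed

text \<open>The \<open>c j\<close> are the coefficients of the kernel that reproduces the value at \<open>1\<close> for the weight
  \<open>t\<^sup>n\<^sup>-\<^sup>1\<close>, i.e. the row sums of the inverse of a Hilbert-type matrix. They are the residues in the
  partial fraction decomposition of \<open>1 - N(x) / D(x)\<close>, where
  \<open>N(x) = \<Prod>i\<le>r. x - i\<close> and \<open>D(x) = \<Prod>j\<le>r. x + j + n\<close>; their sum is a leading coefficient.\<close>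

lemma hilbert_kernel:
  fixes r n :: nat
  assumes "n \<ge> 1"
  obtains c :: "nat \<Rightarrow> real"
  where "\<And>i. i \<le> r \<Longrightarrow> (\<Sum>j\<le>r. c j / real (i + j + n)) = 1"
    and "(\<Sum>j\<le>r. c j) = real ((r + 1) * (r + n))"
proof -
  define x where "x j = - real (j + n)" for j
  define D where "D = (\<Prod>j\<le>r. [:real (j + n), 1:])"
  define N where "N = (\<Prod>i\<le>r. [:- real i, 1:])"
  \<comment> \<open>Both products are monic of degree r + 1, so the difference has degree at most r
    and is determined by its values at the r + 1 roots \<open>x j\<close> of
    \<open>D\<close>.\<close>
  define Q where "Q = D - N"
  define L where "L j = (\<Prod>k\<in>{..r} - {j}. [:real (k + n), 1:])" for j
  define c where "c j = poly Q (x j) / poly (L j) (x j)" for j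
  have L0: "poly (L j) (x i) = 0" if "i \<le> r" "i \<noteq> j" for i j
    using that by (auto simp: L_def x_def poly_prod intro!: prod_zero)
  have L1: "poly (L j) (x j) \<noteq> 0" for j
    by (auto simp: L_def x_def poly_prod)
  have cardL: "card ({..r} - {j}) = r" if "j \<le> r" for j
    using that by (simp add: card_Diff_singleton)
  have degL: "degree (L j) = r" and coeffL: "coeff (L j) r = 1" if "j \<le> r" for j
    using prod_linear_factors(1,2)[of "{..r} - {j}" "\<lambda>k. real (k + n)"] cardL[OF that]
    by (auto simp: L_def)
  have degDN: "degree D = Suc r" "degree N = Suc r"
    unfolding D_def N_def by (subst prod_linear_factors(1); simp)+
  have leadDN: "coeff D (Suc r) = 1" "coeff N (Suc r) = 1"
    using prod_linear_factors(2)[of "{..r}" "\<lambda>k. real (k + n)"]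
      prod_linear_factors(2)[of "{..r}" "\<lambda>k. - real k"]
    by (simp_all add: D_def N_def)
  have degQ: "degree Q \<le> r"
  proof (rule degree_le, intro allI impI)
    fix i assume "r < i"
    then consider "i = Suc r" | "i > Suc r" by linarith
    then show "coeff Q i = 0"
      by cases (use leadDN degDN in \<open>auto simp: Q_def coeff_eq_0\<close>)
  qed
  have inj: "inj_on x {..r}" by (auto simp: inj_on_def x_def)
  \<comment> \<open>Lagrange interpolation at the roots of \<open>D\<close>; \<open>L j\<close> is
    \<open>D\<close> without the factor that vanishes at \<open>x j\<close>.\<close>
  have Q_eq: "Q = (\<Sum>j\<le>r. smult (c j) (L j))"
  proof (rule poly_eqI_degree[of "x ` {..r}"])
    fix y assume "y \<in> x ` {..r}"
    then obtain i where i: "i \<le> r" "y = x i" by auto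
    have "(\<Sum>j\<le>r. c j * poly (L j) (x i)) = (\<Sum>j\<le>r. if j = i then poly Q (x i) else 0)"
      using i L0 L1 by (intro sum.cong) (auto simp: c_def)
    then show "poly Q y = poly (\<Sum>j\<le>r. smult (c j) (L j)) y"
      using i by (simp add: poly_sum)
  next
    show "card (x ` {..r}) > degree Q" using degQ inj by (simp add: card_image)
    have "degree (\<Sum>j\<le>r. smult (c j) (L j)) \<le> r"
      by (intro degree_sum_le) (auto intro: degree_smult_le[THEN order_trans] simp: degL)
    then show "card (x ` {..r}) > degree (\<Sum>j\<le>r. smult (c j) (L j))"
      using inj by (simp add: card_image)
  qed
  show thesis
  proof
    \<comment> \<open>At the integers up to r the product \<open>N\<close> vanishes, so
      \<open>Q\<close> equals \<open>D\<close> there; dividing the interpolation formula by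
      \<open>D\<close> leaves the row sum.\<close>
    fix i assume i: "i \<le> r"
    have N0: "poly N (real i) = 0"
      using i by (auto simp: N_def poly_prod intro!: prod_zero)
    have D_pos: "poly D (real i) > 0"
      using assms by (auto simp: D_def poly_prod intro!: prod_pos)
    have "poly (L j) (real i) = poly D (real i) / real (i + j + n)" if "j \<le> r" for j
      using assms that
      by (simp add: L_def D_def poly_prod prod.remove[of "{..r}" j] field_simps)
    then have "poly Q (real i) = poly D (real i) * (\<Sum>j\<le>r. c j / real (i + j + n))"
      by (simp add: Q_eq poly_sum sum_distrib_left mult.commute)
    then show "(\<Sum>j\<le>r. c j / real (i + j + n)) = 1"
      using N0 D_pos by (simp add: Q_def)
  next
    have "(\<Sum>j\<le>r. c j) = coeff Q r"
      using coeffL by (simp add: Q_eq coeff_sum)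
    also have "\<dots> = (\<Sum>j\<le>r. real (j + n)) + (\<Sum>j\<le>r. real j)"
      using prod_linear_factors(3)[of "{..r}" r "\<lambda>k. real (k + n)"]
        prod_linear_factors(3)[of "{..r}" r "\<lambda>k. - real k"]
      by (simp add: Q_def D_def N_def sum_negf)
    also have "\<dots> = real ((r + 1) * (r + n))"
      by (induction r) (simp_all add: algebra_simps)
    finally show "(\<Sum>j\<le>r. c j) = real ((r + 1) * (r + n))" .
  qed
qed

text \<open>Cauchy-Schwarz for the inner product with weight t^(n - 1): the polynomial
  \<open>K\<close> with coefficients \<open>c j\<close> represents evaluation at 1, so its squared
  norm is its own value at 1, the sum of the \<open>c j\<close>. The weight is the Jacobian of the
  cone coordinates in dimension n.\<close>

lemma poly_endpoint_bound:
  fixes P :: "real poly"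
  assumes P: "degree P \<le> r" and n: "n \<ge> 1"
  shows "(poly P 1)\<^sup>2 \<le> real ((r + 1) * (r + n)) * integral {0..1} (\<lambda>t. t ^ (n - 1) * (poly P t)\<^sup>2)"
proof -
  obtain c where c: "\<And>i. i \<le> r \<Longrightarrow> (\<Sum>j\<le>r. c j / real (i + j + n)) = 1"
    and csum: "(\<Sum>j\<le>r. c j) = real ((r + 1) * (r + n))"
    using hilbert_kernel[OF n] by metis
  define K where "K = (\<Sum>j\<le>r. monom (c j) j)"
  define M where "M = real ((r + 1) * (r + n))"
  have M: "M > 0" using n by (simp add: M_def del: of_nat_mult of_nat_add of_nat_Suc)
  have expand: "poly p t = (\<Sum>i\<le>r. coeff p i * t ^ i)" if "degree p \<le> r" for p :: "real poly" and t
    using that by (simp add: poly_altdef) (intro sum.mono_neutral_left, auto simp: coeff_eq_0)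
  have polyK: "poly K t = (\<Sum>j\<le>r. c j * t ^ j)" for t
    by (simp add: K_def poly_sum poly_monom)
  have degK: "degree K \<le> r"
    unfolding K_def by (intro degree_sum_le) (auto intro: degree_monom_le[THEN order_trans])
  \<comment> \<open>The integral of t^(i + j + n - 1) over the unit interval is 1/(i + j + n), so
    the row sums of the \<open>c j\<close> collapse the double sum to the sum of the coefficients of
    \<open>p\<close>.\<close>
  have repro: "((\<lambda>t. t ^ (n - 1) * (poly K t * poly p t)) has_integral poly p 1) {0..1}"
    if p: "degree p \<le> r" for p
  proof -
    have mono: "((\<lambda>t. t ^ (i + j + n - 1)) has_integral 1 / real (i + j + n)) {0..1::real}" for i j
    proof -
      have "((\<lambda>t. t ^ (i + j + n - 1)) has_integral
          (1 ^ (i + j + n) / real (i + j + n) - 0 ^ (i + j + n) / real (i + j + n))) {0..1::real}"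
      proof (rule fundamental_theorem_of_calculus)
        fix t :: real
        show "((\<lambda>t. t ^ (i + j + n) / real (i + j + n)) has_vector_derivative t ^ (i + j + n - 1))
            (at t within {0..1})"
          using n by (auto intro!: derivative_eq_intros
              simp flip: has_real_derivative_iff_has_vector_derivative)
      qed simp
      then show ?thesis using n by (simp add: zero_power)
    qed
    have "((\<lambda>t. \<Sum>i\<le>r. \<Sum>j\<le>r. coeff p i * c j * t ^ (i + j + n - 1)) has_integral
        (\<Sum>i\<le>r. \<Sum>j\<le>r. coeff p i * c j * (1 / real (i + j + n)))) {0..1}"
      by (intro has_integral_sum has_integral_mult_right mono) auto
    also have "(\<Sum>i\<le>r. \<Sum>j\<le>r. coeff p i * c j * (1 / real (i + j + n)))
        = (\<Sum>i\<le>r. coeff p i * (\<Sum>j\<le>r. c j / real (i + j + n)))"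
      by (simp add: sum_distrib_left)
    also have "\<dots> = poly p 1"
      using c by (simp add: expand[OF p])
    also have "(\<lambda>t. \<Sum>i\<le>r. \<Sum>j\<le>r. coeff p i * c j * t ^ (i + j + n - 1))
        = (\<lambda>t. t ^ (n - 1) * (poly K t * poly p t))"
    proof
      fix t :: real
      have "t ^ (i + j + n - 1) = t ^ (n - 1) * (t ^ i * t ^ j)" for i j
      proof -
        have "i + j + n - 1 = (n - 1) + (i + j)" using n by simp
        then show ?thesis by (simp only: power_add)
      qed
      then show "(\<Sum>i\<le>r. \<Sum>j\<le>r. coeff p i * c j * t ^ (i + j + n - 1))
          = t ^ (n - 1) * (poly K t * poly p t)"
        unfolding polyK expand[OF p] sum_distrib_left sum_distrib_right
        by (intro sum.cong refl) (simp only: mult_ac)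
    qed
    finally show ?thesis .
  qed
  have K1: "poly K 1 = M" using csum by (simp add: polyK M_def)
  define I where "I = integral {0..1} (\<lambda>t. t ^ (n - 1) * (poly P t)\<^sup>2)"
  \<comment> \<open>The minimiser of the squared weighted norm of P - s K; that the minimum is
    nonnegative is the claim.\<close>
  define s where "s = poly P 1 / M"
  have I: "((\<lambda>t. t ^ (n - 1) * (poly P t)\<^sup>2) has_integral I) {0..1}"
    unfolding I_def by (intro integrable_integral integrable_continuous_interval continuous_intros)
  have "((\<lambda>t. t ^ (n - 1) * (poly P t)\<^sup>2 - 2 * s * (t ^ (n - 1) * (poly K t * poly P t))
      + s\<^sup>2 * (t ^ (n - 1) * (poly K t * poly K t))) has_integral
      I - 2 * s * poly P 1 + s\<^sup>2 * poly K 1) {0..1}"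
    by (intro has_integral_add has_integral_diff has_integral_mult_right I repro P degK)
  also have "(\<lambda>t. t ^ (n - 1) * (poly P t)\<^sup>2 - 2 * s * (t ^ (n - 1) * (poly K t * poly P t))
      + s\<^sup>2 * (t ^ (n - 1) * (poly K t * poly K t)))
      = (\<lambda>t. t ^ (n - 1) * (poly P t - s * poly K t)\<^sup>2)"
    by (rule ext) (simp add: power2_eq_square algebra_simps)
  finally have "0 \<le> I - 2 * s * poly P 1 + s\<^sup>2 * poly K 1"
    by (rule has_integral_nonneg) auto
  also have "\<dots> = I - (poly P 1)\<^sup>2 / M"
    using M unfolding s_def K1 by (simp add: field_simps power2_eq_square)
  finally have "(poly P 1)\<^sup>2 \<le> M * I" using M by (simp add: field_simps)
  then show ?thesis unfolding M_def I_def .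
qed

text \<open>The form that can be integrated over an edge with Tonelli's theorem; the open interval
  matches the cones, which omit apex and base.\<close>

lemma poly_endpoint_bound_nn:
  fixes P :: "real poly"
  assumes P: "degree P \<le> r" and n: "n \<ge> 1"
  shows "ennreal ((poly P 1)\<^sup>2) \<le> ennreal (real ((r + 1) * (r + n))) *
    (\<integral>\<^sup>+t. indicator {0<..<1} t * ennreal (t ^ (n - 1) * (poly P t)\<^sup>2) \<partial>lborel)"
proof -
  let ?f = "\<lambda>t. indicator {0<..<1} t * (t ^ (n - 1) * (poly P t)\<^sup>2)"
  let ?I = "integral {0..1} (\<lambda>t. t ^ (n - 1) * (poly P t)\<^sup>2)"
  have "((\<lambda>t. t ^ (n - 1) * (poly P t)\<^sup>2) has_integral ?I) {0..1}"
    by (intro integrable_integral integrable_continuous_interval continuous_intros)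
  then have "((\<lambda>t. t ^ (n - 1) * (poly P t)\<^sup>2) has_integral ?I) {0<..<1}"
    by (simp add: has_integral_Icc_iff_Ioo)
  then have "((\<lambda>t. if t \<in> {0<..<1} then t ^ (n - 1) * (poly P t)\<^sup>2 else 0) has_integral ?I) UNIV"
    by (simp only: has_integral_restrict_UNIV)
  moreover have "(\<lambda>t. if t \<in> {0<..<1} then t ^ (n - 1) * (poly P t)\<^sup>2 else 0) = ?f"
    by (auto simp: indicator_def)
  ultimately have "(\<integral>\<^sup>+t. ennreal (?f t) \<partial>lborel) = ?I"
    using n by (intro nn_integral_has_integral_lborel borel_measurable_times
        borel_measurable_continuous_onI[of "\<lambda>t. t ^ (n - 1) * (poly P t)\<^sup>2"])
      (auto intro!: continuous_intros simp: indicator_def)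
  moreover have "(\<lambda>t. ennreal (?f t))
      = (\<lambda>t. indicator {0<..<1} t * ennreal (t ^ (n - 1) * (poly P t)\<^sup>2))"
    by (auto simp: indicator_def)
  ultimately show ?thesis
    using poly_endpoint_bound[OF assms] by (simp only: ennreal_leI flip: ennreal_mult')
qed

subsection \<open>Surface integrals and integrals over cones\<close>

lemma nn_integral_lborel_translate:
  fixes f :: "'a::euclidean_space \<Rightarrow> ennreal"
  assumes "f \<in> borel_measurable borel"
  shows "(\<integral>\<^sup>+y. f (c + y) \<partial>lborel) = (\<integral>\<^sup>+y. f y \<partial>lborel)"
proof -
  have "(\<integral>\<^sup>+y. f y \<partial>lborel) = (\<integral>\<^sup>+y. f y \<partial>distr lborel borel ((+) c))"
    by (simp add: lborel_distr_plus)
  also have "\<dots> = (\<integral>\<^sup>+y. f (c + y) \<partial>lborel)"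
    using assms by (subst nn_integral_distr) auto
  finally show ?thesis ..
qed

lemma nn_integral_lborel_scale:
  fixes f :: "'a::euclidean_space \<Rightarrow> ennreal"
  assumes [measurable]: "f \<in> borel_measurable borel" and c: "c > 0"
  shows "(\<integral>\<^sup>+y. f y \<partial>lborel) = ennreal (c ^ DIM('a)) * (\<integral>\<^sup>+y. f (c *\<^sub>R y) \<partial>lborel)"
proof -
  have "(\<integral>\<^sup>+y. f y \<partial>lborel) =
      (\<integral>\<^sup>+y. f y \<partial>density (distr lborel borel (\<lambda>x. 0 + c *\<^sub>R x)) (\<lambda>_. \<bar>c\<bar> ^ DIM('a)))"
    using c by (subst lborel_affine[of c 0]) auto
  also have "\<dots> = ennreal (c ^ DIM('a)) * (\<integral>\<^sup>+y. f (c *\<^sub>R y) \<partial>lborel)"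
    using c by (simp add: nn_integral_density nn_integral_distr nn_integral_cmult)
  finally show ?thesis .
qed

text \<open>For linear \<open>l\<close> with \<open>l m = 1\<close> this is the projection onto the
  kernel of \<open>l\<close> along \<open>m\<close>.\<close>

definition flat :: "('a \<Rightarrow> real) \<Rightarrow> 'a \<Rightarrow> 'a \<Rightarrow> 'a::real_vector" where
  "flat l m y = y - l y *\<^sub>R m"

context
  fixes l :: "'a::euclidean_space \<Rightarrow> real" and m :: 'a
  assumes lin: "bounded_linear l" and lm: "l m = 1"
begin

lemma flat_measurable: "flat l m \<in> borel_measurable borel"
  unfolding flat_def using lin
  by (intro borel_measurable_continuous_onI continuous_intros linear_continuous_on)

lemma level_measurable: "l \<in> borel_measurable borel"
  using lin by (intro borel_measurable_continuous_onI linear_continuous_on)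

lemma level_simps: "l (x + y) = l x + l y" "l (x - y) = l x - l y" "l (c *\<^sub>R x) = c * l x"
  using lin by (simp_all add: linear_simps)

lemma flat_simps:
  "l (flat l m y) = 0" "flat l m (flat l m y) = flat l m y"
  "flat l m (x + c *\<^sub>R m) = flat l m x" "flat l m (c *\<^sub>R x) = c *\<^sub>R flat l m x"
  by (simp_all add: flat_def level_simps lm algebra_simps)

text \<open>Fubini's theorem for the splitting of the space into the kernel of \<open>l\<close> and the line spanned
  by \<open>m\<close>. It needs no measure on the kernel, because the weight \<open>A\<close> integrates out the
  redundant coordinate; the proof only uses the translation invariance of Lebesgue measure.\<close>

lemma nn_integral_split:
  fixes A :: "real \<Rightarrow> ennreal" and f :: "'a \<Rightarrow> ennreal"
  assumes [measurable]: "A \<in> borel_measurable borel" "f \<in> borel_measurable borel"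
  shows "(\<integral>\<^sup>+t. A t \<partial>lborel) * (\<integral>\<^sup>+y. f y \<partial>lborel)
    = (\<integral>\<^sup>+y. A (l y) * (\<integral>\<^sup>+t. f (flat l m y + t *\<^sub>R m) \<partial>lborel) \<partial>lborel)"
proof -
  note flat_measurable[measurable] level_measurable[measurable]
  have "(\<integral>\<^sup>+t. A t \<partial>lborel) * (\<integral>\<^sup>+y. f y \<partial>lborel)
      = (\<integral>\<^sup>+y. \<integral>\<^sup>+t. A t * f y \<partial>lborel \<partial>lborel)"
    by (simp add: nn_integral_cmult nn_integral_multc)
  also have "\<dots> = (\<integral>\<^sup>+y. \<integral>\<^sup>+t. A (l y + t) * f y \<partial>lborel \<partial>lborel)"
    by (intro nn_integral_cong nn_integral_lborel_translate[symmetric]) simp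
  also have "\<dots> = (\<integral>\<^sup>+t. \<integral>\<^sup>+y. A (l y + t) * f y \<partial>lborel \<partial>lborel)"
    by (rule lborel_pair.Fubini'[symmetric]) (simp add: case_prod_unfold)
  \<comment> \<open>Moving y by -t m lowers its level by t, as \<open>l m = 1\<close>, and so
    removes t from the argument of \<open>A\<close>.\<close>
  also have "\<dots> = (\<integral>\<^sup>+t. \<integral>\<^sup>+y. A (l y) * f (- t *\<^sub>R m + y) \<partial>lborel \<partial>lborel)"
  proof (rule nn_integral_cong)
    fix t
    show "(\<integral>\<^sup>+y. A (l y + t) * f y \<partial>lborel) = (\<integral>\<^sup>+y. A (l y) * f (- t *\<^sub>R m + y) \<partial>lborel)"
      using nn_integral_lborel_translate[of "\<lambda>y. A (l y + t) * f y" "- t *\<^sub>R m"]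
      by (simp add: level_simps lm)
  qed
  also have "\<dots> = (\<integral>\<^sup>+y. \<integral>\<^sup>+t. A (l y) * f (- t *\<^sub>R m + y) \<partial>lborel \<partial>lborel)"
    by (rule lborel_pair.Fubini') (simp add: case_prod_unfold)
  also have "\<dots> = (\<integral>\<^sup>+y. A (l y) * (\<integral>\<^sup>+t. f (flat l m y + t *\<^sub>R m) \<partial>lborel) \<partial>lborel)"
  proof (rule nn_integral_cong)
    fix y
    have "(\<integral>\<^sup>+t. f (- t *\<^sub>R m + y) \<partial>lborel) = (\<integral>\<^sup>+t. f (- (l y - t) *\<^sub>R m + y) \<partial>lborel)"
      by (subst nn_integral_real_affine[where c = "-1" and t = "l y"]) auto
    then show "(\<integral>\<^sup>+t. A (l y) * f (- t *\<^sub>R m + y) \<partial>lborel)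
        = A (l y) * (\<integral>\<^sup>+t. f (flat l m y + t *\<^sub>R m) \<partial>lborel)"
      by (simp add: nn_integral_cmult flat_def algebra_simps)
  qed
  finally show ?thesis .
qed

text \<open>An integral over a thickened kernel depends on the weight across it only through its
  total mass, because the line integral of the splitting formula factors. This lets one thickening
  be exchanged for another.\<close>

lemma nn_integral_product:
  fixes A B :: "real \<Rightarrow> ennreal" and f :: "'a \<Rightarrow> ennreal"
  assumes [measurable]: "A \<in> borel_measurable borel" "B \<in> borel_measurable borel"
    "f \<in> borel_measurable borel"
  shows "(\<integral>\<^sup>+t. A t \<partial>lborel) * (\<integral>\<^sup>+y. B (l y) * f (flat l m y) \<partial>lborel)
    = (\<integral>\<^sup>+t. B t \<partial>lborel) * (\<integral>\<^sup>+y. A (l y) * f (flat l m y) \<partial>lborel)"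
  using flat_measurable[measurable] level_measurable[measurable]
  by (subst nn_integral_split)
    (simp_all add: level_simps flat_simps lm nn_integral_multc nn_integral_cmult[symmetric] mult_ac)

text \<open>The slice at level t > 0 is written as the dilate by t of a slice at level 1. Dilation
  of the whole space contributes t^n, but it also turns the unit window \<open>A\<close> into one of
  length 1/t, which leaves t^(n - 1).\<close>

lemma nn_integral_cone:
  fixes f :: "'a \<Rightarrow> ennreal"
  assumes [measurable]: "f \<in> borel_measurable borel"
    and supp: "\<And>x. l x \<le> 0 \<Longrightarrow> f x = 0"
  shows "(\<integral>\<^sup>+x. f x \<partial>lborel) = (\<integral>\<^sup>+y. indicator {0..1} (l y) *
    (\<integral>\<^sup>+t. ennreal (t ^ (DIM('a) - 1)) * f (t *\<^sub>R (flat l m y + m)) \<partial>lborel) \<partial>lborel)"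
proof -
  note flat_measurable[measurable] level_measurable[measurable]
  define A :: "real \<Rightarrow> ennreal" where "A = indicator {0..1}"
  have A[measurable]: "A \<in> borel_measurable borel" and A1: "(\<integral>\<^sup>+t. A t \<partial>lborel) = 1"
    by (simp_all add: A_def)
  have "(\<integral>\<^sup>+x. f x \<partial>lborel) = (\<integral>\<^sup>+y. \<integral>\<^sup>+t. A (l y) * f (flat l m y + t *\<^sub>R m) \<partial>lborel \<partial>lborel)"
    using nn_integral_split[OF A assms(1)] by (simp add: A1 nn_integral_cmult)
  also have "\<dots> = (\<integral>\<^sup>+t. \<integral>\<^sup>+y. A (l y) * f (flat l m y + t *\<^sub>R m) \<partial>lborel \<partial>lborel)"
    by (rule lborel_pair.Fubini'[symmetric]) (simp add: case_prod_unfold)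
  also have "\<dots> = (\<integral>\<^sup>+t. \<integral>\<^sup>+y. A (l y) * (ennreal (t ^ (DIM('a) - 1)) * f (t *\<^sub>R (flat l m y + m)))
      \<partial>lborel \<partial>lborel)"
  proof (rule nn_integral_cong)
    fix t :: real
    show "(\<integral>\<^sup>+y. A (l y) * f (flat l m y + t *\<^sub>R m) \<partial>lborel)
      = (\<integral>\<^sup>+y. A (l y) * (ennreal (t ^ (DIM('a) - 1)) * f (t *\<^sub>R (flat l m y + m))) \<partial>lborel)"
    proof (cases "t > 0")
      case False
      then have "f (flat l m y + t *\<^sub>R m) = 0" "f (t *\<^sub>R (flat l m y + m)) = 0" for y
        by (auto intro!: supp simp: level_simps flat_simps lm)
      then show ?thesis by simp
    next
      case t: True
      \<comment> \<open>The mass of the window after the dilation;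
        \<open>nn_integral_product\<close> trades it for the original window at the cost of this
        factor.\<close>
      have len: "(\<integral>\<^sup>+s. A (t * s) \<partial>lborel) = ennreal (1 / t)"
      proof -
        have "ennreal (1 / t) = ennreal (1 / t) * (ennreal t * (\<integral>\<^sup>+s. A (t * s) \<partial>lborel))"
          using nn_integral_real_affine[of A t 0] A1 t by simp
        also have "\<dots> = (\<integral>\<^sup>+s. A (t * s) \<partial>lborel)"
          using t by (simp add: mult.assoc[symmetric] ennreal_mult'[symmetric])
        finally show ?thesis ..
      qed
      have "(\<integral>\<^sup>+y. A (l y) * f (flat l m y + t *\<^sub>R m) \<partial>lborel)
          = ennreal (t ^ DIM('a)) * (\<integral>\<^sup>+y. A (t * l y) * f (t *\<^sub>R (flat l m y + m)) \<partial>lborel)"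
        using t by (subst nn_integral_lborel_scale[of _ t])
          (simp_all add: level_simps flat_simps scaleR_add_right)
      also have "(\<integral>\<^sup>+y. A (t * l y) * f (t *\<^sub>R (flat l m y + m)) \<partial>lborel)
          = ennreal (1 / t) * (\<integral>\<^sup>+y. A (l y) * f (t *\<^sub>R (flat l m y + m)) \<partial>lborel)"
        using nn_integral_product[of A "\<lambda>s. A (t * s)" "\<lambda>x. f (t *\<^sub>R (x + m))"] len
        by (simp add: A1)
      also have "ennreal (t ^ DIM('a)) * (ennreal (1 / t) * (\<integral>\<^sup>+y. A (l y) * f (t *\<^sub>R (flat l m y + m)) \<partial>lborel))
          = ennreal (t ^ (DIM('a) - 1)) * (\<integral>\<^sup>+y. A (l y) * f (t *\<^sub>R (flat l m y + m)) \<partial>lborel)"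
      proof -
        have "t ^ DIM('a) * (1 / t) = t ^ (DIM('a) - 1)"
          using t DIM_positive[where 'a = 'a] by (simp add: power_diff)
        then show ?thesis
          using t by (simp add: mult.assoc[symmetric] ennreal_mult'[symmetric])
      qed
      also have "\<dots> = (\<integral>\<^sup>+y. A (l y) * (ennreal (t ^ (DIM('a) - 1)) * f (t *\<^sub>R (flat l m y + m))) \<partial>lborel)"
        by (simp add: nn_integral_cmult[symmetric] mult_ac)
      finally show ?thesis .
    qed
  qed
  also have "\<dots> = (\<integral>\<^sup>+y. \<integral>\<^sup>+t. A (l y) * (ennreal (t ^ (DIM('a) - 1)) * f (t *\<^sub>R (flat l m y + m)))
      \<partial>lborel \<partial>lborel)"
    by (rule lborel_pair.Fubini') (simp add: case_prod_unfold)
  finally show ?thesis by (simp add: nn_integral_cmult A_def)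
qed

end

section \<open>Edge integrals as Lebesgue integrals over prisms, and their comparison with
  cones\<close>

lemma nn_integral_compact:
  fixes f :: "'a::euclidean_space \<Rightarrow> real"
  assumes "compact S" "continuous_on S f"
  shows "f integrable_on S"
    and "(\<And>x. x \<in> S \<Longrightarrow> f x \<ge> 0) \<Longrightarrow>
      (\<integral>\<^sup>+x. indicator S x * ennreal (f x) \<partial>lborel) = ennreal (integral S f)"
proof -
  have int: "set_integrable lborel S f"
    using borel_integrable_compact[OF assms] by (simp add: set_integrable_def)
  show "f integrable_on S"
    using set_borel_integral_eq_integral(1)[OF int] .
  assume nn: "\<And>x. x \<in> S \<Longrightarrow> f x \<ge> 0"
  have "(\<integral>\<^sup>+x. indicator S x * ennreal (f x) \<partial>lborel)
      = (\<integral>\<^sup>+x. ennreal (indicator S x *\<^sub>R f x) \<partial>lborel)"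
    by (intro nn_integral_cong) (auto simp: indicator_def)
  also have "\<dots> = ennreal (set_lebesgue_integral lborel S f)"
    unfolding set_lebesgue_integral_def using int nn
    by (intro nn_integral_eq_integral) (auto simp: set_integrable_def indicator_def)
  also have "\<dots> = ennreal (integral S f)"
    using set_borel_integral_eq_integral(2)[OF int] by simp
  finally show "(\<integral>\<^sup>+x. indicator S x * ennreal (f x) \<partial>lborel) = ennreal (integral S f)" .
qed

lemma closest_point_hyperplane:
  fixes a y :: "'a::euclidean_space"
  assumes "norm a = 1"
  shows "closest_point {z. a \<bullet> z = b} y = y - (a \<bullet> y - b) *\<^sub>R a"
proof (rule closest_point_unique[symmetric])
  have aa: "a \<bullet> a = 1" using assms by (simp add: norm_eq_1)
  then show "y - (a \<bullet> y - b) *\<^sub>R a \<in> {z. a \<bullet> z = b}"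
    by (simp add: inner_diff_right)
  show "\<forall>z\<in>{z. a \<bullet> z = b}. dist y (y - (a \<bullet> y - b) *\<^sub>R a) \<le> dist y z"
  proof
    fix z assume "z \<in> {z. a \<bullet> z = b}"
    then have "\<bar>a \<bullet> y - b\<bar> = \<bar>a \<bullet> (y - z)\<bar>" by (simp add: inner_diff_right)
    also have "\<dots> \<le> norm (y - z)" using Cauchy_Schwarz_ineq2[of a "y - z"] assms by simp
    finally show "dist y (y - (a \<bullet> y - b) *\<^sub>R a) \<le> dist y z"
      using assms by (simp add: dist_norm)
  qed
qed (simp_all add: convex_hyperplane closed_hyperplane)

lemma rel_interior_borel: "rel_interior S \<in> sets borel" for S :: "'a::euclidean_space set"
proof -
  obtain T where "open T" "rel_interior S = affine hull S \<inter> T"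
    using openin_rel_interior[of S] by (auto simp: openin_open)
  then show ?thesis by (simp add: borel_open borel_closed closed_affine_hull sets.Int)
qed

text \<open>The apex is left out because it is common to all cones of an element, which are to be
  disjoint.\<close>

definition open_cone :: "'a::real_vector \<Rightarrow> 'a set \<Rightarrow> 'a set" where
  "open_cone x0 R = {x0 + t *\<^sub>R (z - x0) | t z. 0 < t \<and> t < 1 \<and> z \<in> R}"

text \<open>The cone is given as an image, but it is also a preimage: the affine function
  \<open>l\<close>, equal to 0 at the apex and 1 on the hyperplane of the base, recovers the
  parameter t, and then the base point.\<close>

lemma open_cone_borel:
  fixes a x0 :: "'a::euclidean_space"
  assumes R: "R \<in> sets borel" "R \<subseteq> {z. a \<bullet> z = b}" and d: "b \<noteq> a \<bullet> x0"
  shows "open_cone x0 R \<in> sets borel"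
proof -
  note R(1)[measurable]
  define l where "l x = (a \<bullet> (x - x0)) / (b - a \<bullet> x0)" for x
  have [measurable]: "l \<in> borel_measurable borel" unfolding l_def by measurable
  have l: "l (x0 + t *\<^sub>R (z - x0)) = t" if "z \<in> R" for t z
    using that R(2) d by (auto simp: l_def inner_diff_right)
  have "x \<in> open_cone x0 R \<longleftrightarrow> 0 < l x \<and> l x < 1 \<and> x0 + (1 / l x) *\<^sub>R (x - x0) \<in> R" for x
  proof
    assume "x \<in> open_cone x0 R"
    then obtain t z where "x = x0 + t *\<^sub>R (z - x0)" "0 < t" "t < 1" "z \<in> R"
      by (auto simp: open_cone_def)
    then show "0 < l x \<and> l x < 1 \<and> x0 + (1 / l x) *\<^sub>R (x - x0) \<in> R"
      using l[of z t] by simp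
  next
    assume *: "0 < l x \<and> l x < 1 \<and> x0 + (1 / l x) *\<^sub>R (x - x0) \<in> R"
    then have "x = x0 + l x *\<^sub>R ((x0 + (1 / l x) *\<^sub>R (x - x0)) - x0)"
      by (simp add: scaleR_scaleR del: scaleR_right_diff_distrib)
    with * show "x \<in> open_cone x0 R" unfolding open_cone_def by blast
  qed
  then have "open_cone x0 R = {x. 0 < l x \<and> l x < 1 \<and> x0 + (1 / l x) *\<^sub>R (x - x0) \<in> R}"
    by (simp add: set_eq_iff)
  also have "\<dots> \<in> sets borel" by measurable
  finally show ?thesis .
qed

text \<open>The prism is the Minkowski sum of the edge and a unit segment in the normal direction,
  and inherits compactness and convexity from the two summands.\<close>

lemma unit_prism_hyperplane:
  fixes e :: "(real^'n) set"
  assumes e: "compact e" "convex e" and hull: "affine hull e = {z. a \<bullet> z = b}" and a: "norm a = 1"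
  shows "unit_prism e = {y. y - (a \<bullet> y - b) *\<^sub>R a \<in> e \<and> \<bar>a \<bullet> y - b\<bar> \<le> 1/2}"
    and "compact (unit_prism e)" and "convex (unit_prism e)"
proof -
  have aa: "a \<bullet> a = 1" using a by (simp add: norm_eq_1)
  show eq: "unit_prism e = {y. y - (a \<bullet> y - b) *\<^sub>R a \<in> e \<and> \<bar>a \<bullet> y - b\<bar> \<le> 1/2}"
    using a by (simp add: unit_prism_def hull closest_point_hyperplane dist_norm)
  define S where "S = (\<lambda>s. s *\<^sub>R a) ` {-1/2..1/2::real}"
  have "unit_prism e = (\<Union>x\<in>e. \<Union>y\<in>S. {x + y})"
  proof (intro set_eqI iffI)
    fix y assume "y \<in> unit_prism e"
    moreover have "y = (y - (a \<bullet> y - b) *\<^sub>R a) + (a \<bullet> y - b) *\<^sub>R a" by simp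
    moreover have "a \<bullet> y - b \<in> {- 1/2..1/2}"
      using \<open>y \<in> unit_prism e\<close> unfolding eq mem_Collect_eq atLeastAtMost_iff by arith
    ultimately show "y \<in> (\<Union>x\<in>e. \<Union>y\<in>S. {x + y})"
      unfolding eq S_def
      by (intro UN_I[of "y - (a \<bullet> y - b) *\<^sub>R a" e] UN_I[of "(a \<bullet> y - b) *\<^sub>R a"] imageI)
        auto
  next
    fix y assume "y \<in> (\<Union>x\<in>e. \<Union>y\<in>S. {x + y})"
    then obtain x s where "x \<in> e" "s \<in> {-1/2..1/2}" "y = x + s *\<^sub>R a" by (auto simp: S_def)
    moreover from this have "a \<bullet> x = b" using hull hull_subset[of e affine] by auto
    ultimately show "y \<in> unit_prism e" unfolding eq by (auto simp: inner_add_right aa)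
  qed
  moreover have "compact S" unfolding S_def
    by (intro compact_continuous_image continuous_intros) simp
  moreover have "convex S" unfolding S_def
    by (intro convex_linear_image) (auto intro: bounded_linear.linear bounded_linear_scaleR_left)
  ultimately show "compact (unit_prism e)" "convex (unit_prism e)"
    using e compact_sums'[of e S] convex_sums[of e S] by simp_all
qed

text \<open>Passing to the relative interior of the edge changes the prism only within its frontier,
  a null set by convexity. Relative interiors are what is shown later to be disjoint for distinct
  edges.\<close>

lemma edge_integral_hyperplane:
  fixes e :: "(real^'n) set"
  assumes e: "compact e" "convex e" and hull: "affine hull e = {z. a \<bullet> z = b}" and a: "norm a = 1"
    and f: "continuous_on e f"
  shows "(\<lambda>y. f (closest_point (affine hull e) y)) integrable_on unit_prism e"
    and "(\<And>x. x \<in> e \<Longrightarrow> f x \<ge> 0) \<Longrightarrow> ennreal (edge_integral e f) =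
      (\<integral>\<^sup>+y. indicator {y. y - (a \<bullet> y - b) *\<^sub>R a \<in> rel_interior e \<and> \<bar>a \<bullet> y - b\<bar> \<le> 1/2} y *
        ennreal (f (y - (a \<bullet> y - b) *\<^sub>R a)) \<partial>lborel)"
proof -
  note prism = unit_prism_hyperplane[OF e hull a]
  define p where "p y = y - (a \<bullet> y - b) *\<^sub>R a" for y
  have p: "closest_point (affine hull e) y = p y" for y
    using a by (simp add: hull closest_point_hyperplane p_def)
  have cont: "continuous_on (unit_prism e) (\<lambda>y. f (p y))"
    by (rule continuous_on_compose2[OF f])
      (auto simp: prism(1) p_def intro!: continuous_intros)
  show "(\<lambda>y. f (closest_point (affine hull e) y)) integrable_on unit_prism e"
    unfolding p by (rule nn_integral_compact[OF prism(2) cont])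
  assume nn: "\<And>x. x \<in> e \<Longrightarrow> f x \<ge> 0"
  have int: "p y \<in> rel_interior e" if y: "y \<in> interior (unit_prism e)" for y
  proof -
    obtain r where r: "r > 0" "ball y r \<subseteq> unit_prism e"
      using y by (auto simp: mem_interior)
    have "p y \<in> e" using y interior_subset by (auto simp: prism(1) p_def)
    moreover have "ball (p y) r \<inter> affine hull e \<subseteq> e"
    proof
      fix z assume z: "z \<in> ball (p y) r \<inter> affine hull e"
      define y' where "y' = z + (a \<bullet> y - b) *\<^sub>R a"
      have "y - y' = p y - z" by (simp add: p_def y'_def)
      then have "y' \<in> ball y r" using z by (simp add: dist_norm)
      moreover have "p y' = z" using z a by (simp add: p_def y'_def hull inner_add_right norm_eq_1)
      ultimately show "z \<in> e" using r by (auto simp: prism(1) p_def)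
    qed
    ultimately show ?thesis using r(1) by (auto simp: mem_rel_interior_ball)
  qed
  have "frontier (unit_prism e) \<in> null_sets lborel"
  proof -
    have "frontier (unit_prism e) \<in> null_sets lebesgue"
      using negligible_convex_frontier[OF prism(3)] by (simp add: negligible_iff_null_sets)
    then show ?thesis
      by (subst (asm) null_sets_completion_iff) (auto intro: borel_closed)
  qed
  then have "AE y in lborel. y \<notin> frontier (unit_prism e)" by (rule AE_not_in)
  then have AE: "AE y in lborel. y \<in> unit_prism e \<longleftrightarrow> p y \<in> rel_interior e \<and> \<bar>a \<bullet> y - b\<bar> \<le> 1/2"
  proof eventually_elim
    case (elim y)
    have "y \<in> interior (unit_prism e)" if "y \<in> unit_prism e"
      using elim that closure_subset by (auto simp: frontier_def)
    then show ?case
      using int interior_subset[of "unit_prism e"] rel_interior_subset[of e]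
      by (auto simp: prism(1) p_def)
  qed
  have "ennreal (edge_integral e f) = (\<integral>\<^sup>+y. indicator (unit_prism e) y * ennreal (f (p y)) \<partial>lborel)"
    unfolding edge_integral_def p
    by (rule nn_integral_compact(2)[OF prism(2) cont, symmetric]) (auto simp: prism(1) p_def nn)
  also have "\<dots> = (\<integral>\<^sup>+y. indicator {y. p y \<in> rel_interior e \<and> \<bar>a \<bullet> y - b\<bar> \<le> 1/2} y * ennreal (f (p y)) \<partial>lborel)"
    using AE by (intro nn_integral_cong_AE) (auto elim!: eventually_mono simp: indicator_def)
  finally show "ennreal (edge_integral e f) =
      (\<integral>\<^sup>+y. indicator {y. y - (a \<bullet> y - b) *\<^sub>R a \<in> rel_interior e \<and> \<bar>a \<bullet> y - b\<bar> \<le> 1/2} y *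
        ennreal (f (y - (a \<bullet> y - b) *\<^sub>R a)) \<partial>lborel)"
    by (simp add: p_def)
qed

text \<open>The ray bound is integrated over the base and read in cone coordinates with origin
  \<open>x0\<close>. Here \<open>d\<close> is the distance of \<open>x0\<close> from the hyperplane
  and \<open>l\<close> is normalised to 1 on it, so the prism, of thickness 1, has thickness 1/d as
  measured by \<open>l\<close>; this produces the factor 1/d.\<close>

lemma edge_integral_le_cone:
  fixes e :: "(real^'n) set"
  assumes e: "compact e" "convex e" and hull: "affine hull e = {z. a \<bullet> z = b}" and a: "norm a = 1"
    and d: "d = b - a \<bullet> x0" "d > 0"
    and g: "continuous_on UNIV g" "\<And>x. g x \<ge> 0"
    and ray: "\<And>z. ennreal (g z) \<le> c * (\<integral>\<^sup>+t. indicator {0<..<1} t *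
        ennreal (t ^ (CARD('n) - 1) * g (x0 + t *\<^sub>R (z - x0))) \<partial>lborel)"
  shows "ennreal (edge_integral e g) \<le>
    ennreal (1 / d) * (c * (\<integral>\<^sup>+x. indicator (open_cone x0 (rel_interior e)) x * ennreal (g x) \<partial>lborel))"
proof -
  define R where "R = rel_interior e"
  define l where "l y = (a \<bullet> y) / d" for y
  define m where "m = d *\<^sub>R a"
  define A :: "real \<Rightarrow> ennreal" where "A = indicator {0..1}"
  \<comment> \<open>The window of the prism in terms of \<open>l\<close>, after the origin has been
    moved to \<open>x0\<close>.\<close>
  define B :: "real \<Rightarrow> ennreal" where "B = indicator {1 - 1 / (2 * d)..1 + 1 / (2 * d)}"
  define f where "f x = indicator R (x0 + x + m) * ennreal (g (x0 + x + m))" for x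
  define h where "h x = indicator (open_cone x0 R) (x0 + x) * ennreal (g (x0 + x))" for x
  have aa: "a \<bullet> a = 1" using a by (simp add: norm_eq_1)
  have lin: "bounded_linear l" unfolding l_def
    by (intro bounded_linear_divide[THEN bounded_linear_compose] bounded_linear_inner_right)
  have lm: "l m = 1" using d aa by (simp add: l_def m_def)
  have R_sub: "R \<subseteq> {z. a \<bullet> z = b}"
    using rel_interior_subset hull_subset[of e affine] hull by (auto simp: R_def)
  have [measurable]: "R \<in> sets borel" by (simp add: R_def rel_interior_borel)
  have [measurable]: "open_cone x0 R \<in> sets borel"
    using d by (intro open_cone_borel[OF _ R_sub]) auto
  have [measurable]: "g \<in> borel_measurable borel" by (rule borel_measurable_continuous_onI[OF g(1)])
  have [measurable]: "f \<in> borel_measurable borel" "h \<in> borel_measurable borel"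
    unfolding f_def h_def by measurable
  have [measurable]: "A \<in> borel_measurable borel" "B \<in> borel_measurable borel"
    by (simp_all add: A_def B_def)
  have [measurable]: "l \<in> borel_measurable borel" by (rule level_measurable[OF lin lm])
  have flat: "flat l m y = y - (a \<bullet> y) *\<^sub>R a" for y
    using d(2) by (simp add: flat_def l_def m_def)
  have [measurable]: "flat l m \<in> borel_measurable borel" by (rule flat_measurable[OF lin lm])
  have shift: "x0 + y - (a \<bullet> (x0 + y) - b) *\<^sub>R a = x0 + flat l m y + m" for y
    unfolding flat unfolding m_def d by (simp add: inner_add_right algebra_simps)
  have B: "\<bar>a \<bullet> (x0 + y) - b\<bar> \<le> 1/2 \<longleftrightarrow> l y \<in> {1 - 1 / (2 * d)..1 + 1 / (2 * d)}" for y
  proof -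
    have "a \<bullet> (x0 + y) - b = d * l y - d"
      using d by (simp add: l_def inner_add_right)
    moreover have "1 - 1 / (2 * d) \<le> l y \<longleftrightarrow> d - 1/2 \<le> d * l y"
      "l y \<le> 1 + 1 / (2 * d) \<longleftrightarrow> d * l y \<le> d + 1/2"
      using d(2) by (simp_all add: field_simps)
    ultimately show ?thesis unfolding atLeastAtMost_iff by arith
  qed
  have "ennreal (edge_integral e g) = (\<integral>\<^sup>+y. indicator {y. y - (a \<bullet> y - b) *\<^sub>R a \<in> R \<and> \<bar>a \<bullet> y - b\<bar> \<le> 1/2} y *
        ennreal (g (y - (a \<bullet> y - b) *\<^sub>R a)) \<partial>lborel)"
    using edge_integral_hyperplane(2)[OF e hull a continuous_on_subset[OF g(1)]] g(2)
    by (simp add: R_def)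
  also have "\<dots> = (\<integral>\<^sup>+y. indicator {y. y - (a \<bullet> y - b) *\<^sub>R a \<in> R \<and> \<bar>a \<bullet> y - b\<bar> \<le> 1/2} (x0 + y) *
        ennreal (g (x0 + y - (a \<bullet> (x0 + y) - b) *\<^sub>R a)) \<partial>lborel)"
    by (rule nn_integral_lborel_translate[symmetric]) measurable
  also have "\<dots> = (\<integral>\<^sup>+y. B (l y) * f (flat l m y) \<partial>lborel)"
    unfolding f_def B_def indicator_def mem_Collect_eq shift B
    by (intro nn_integral_cong) simp
  also have "\<dots> = (\<integral>\<^sup>+t. A t \<partial>lborel) * (\<integral>\<^sup>+y. B (l y) * f (flat l m y) \<partial>lborel)"
    by (simp add: A_def)
  also have "\<dots> = (\<integral>\<^sup>+t. B t \<partial>lborel) * (\<integral>\<^sup>+y. A (l y) * f (flat l m y) \<partial>lborel)"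
    by (rule nn_integral_product[OF lin lm]) measurable
  also have "(\<integral>\<^sup>+t. B t \<partial>lborel) = ennreal (1 / d)"
    using d(2) by (simp add: B_def)
  also have "(\<integral>\<^sup>+y. A (l y) * f (flat l m y) \<partial>lborel) \<le> (\<integral>\<^sup>+y. c * (A (l y) *
      (\<integral>\<^sup>+t. ennreal (t ^ (DIM(real^'n) - 1)) * h (t *\<^sub>R (flat l m y + m)) \<partial>lborel)) \<partial>lborel)"
  proof (rule nn_integral_mono)
    fix y
    define z where "z = x0 + flat l m y + m"
    have "f (flat l m y) \<le> c *
      (\<integral>\<^sup>+t. ennreal (t ^ (DIM(real^'n) - 1)) * h (t *\<^sub>R (flat l m y + m)) \<partial>lborel)"
    proof (cases "z \<in> R")
      case True
      have "f (flat l m y) = ennreal (g z)" using True by (simp add: f_def z_def)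
      also have "\<dots> \<le> c * (\<integral>\<^sup>+t. indicator {0<..<1} t *
        ennreal (t ^ (CARD('n) - 1) * g (x0 + t *\<^sub>R (z - x0))) \<partial>lborel)" by (rule ray)
      also have "\<dots> \<le> c *
      (\<integral>\<^sup>+t. ennreal (t ^ (DIM(real^'n) - 1)) * h (t *\<^sub>R (flat l m y + m)) \<partial>lborel)"
      proof (intro mult_left_mono nn_integral_mono)
        fix t :: real
        have "x0 + t *\<^sub>R (z - x0) \<in> open_cone x0 R" if "t \<in> {0<..<1}"
          using that True by (auto simp: open_cone_def)
        moreover have "x0 + t *\<^sub>R (z - x0) = x0 + t *\<^sub>R (flat l m y + m)"
          by (simp add: z_def add.assoc)
        ultimately show "indicator {0<..<1} t * ennreal (t ^ (CARD('n) - 1) * g (x0 + t *\<^sub>R (z - x0)))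
          \<le> ennreal (t ^ (DIM(real^'n) - 1)) * h (t *\<^sub>R (flat l m y + m))"
          by (auto simp: indicator_def h_def ennreal_mult' g(2))
      qed simp
      finally show ?thesis .
    qed (simp add: f_def z_def)
    then show "A (l y) * f (flat l m y) \<le> c * (A (l y) *
      (\<integral>\<^sup>+t. ennreal (t ^ (DIM(real^'n) - 1)) * h (t *\<^sub>R (flat l m y + m)) \<partial>lborel))"
      using mult_left_mono[of _ _ "A (l y)"] by (simp only: mult.left_commute[of c] zero_le)
  qed
  also have "\<dots> = c * (\<integral>\<^sup>+x. h x \<partial>lborel)"
  proof -
    have "h x = 0" if "l x \<le> 0" for x
    proof -
      have "x0 + x \<notin> open_cone x0 R"
      proof
        assume "x0 + x \<in> open_cone x0 R"
        then obtain t z where "x = t *\<^sub>R (z - x0)" "0 < t" "z \<in> R"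
          by (auto simp: open_cone_def)
        then have "l x > 0" using R_sub d by (auto simp: l_def inner_diff_right)
        with that show False by simp
      qed
      then show ?thesis by (simp add: h_def)
    qed
    then show ?thesis
      by (subst nn_integral_cone[OF lin lm]) (simp_all add: A_def nn_integral_cmult)
  qed
  also have "(\<integral>\<^sup>+x. h x \<partial>lborel) = (\<integral>\<^sup>+x. indicator (open_cone x0 R) x * ennreal (g x) \<partial>lborel)"
    unfolding h_def by (rule nn_integral_lborel_translate) measurable
  finally show ?thesis by (simp add: R_def mult_left_mono)
qed

subsection \<open>Elements and edges\<close>

text \<open>Near a relative interior point of a flat piece of codimension one, a convex set with an
  interior point on one side fills that side: x + t (u - x) lies on the segment from
  \<open>v\<close> to a point \<open>z t\<close> of the hyperplane, and \<open>z t\<close> tends to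
  \<open>x\<close>, so it belongs to \<open>e\<close> for small t.\<close>

lemma convex_eventually_interior:
  fixes K e :: "'a::euclidean_space set"
  assumes K: "convex K" "e \<subseteq> K" and hull: "affine hull e = {z. a \<bullet> z = b}"
    and x: "x \<in> rel_interior e" and v: "v \<in> interior K" "a \<bullet> v < b" and u: "a \<bullet> u < b"
  shows "\<forall>\<^sub>F t in at_right 0. x + t *\<^sub>R (u - x) \<in> interior K"
proof -
  \<comment> \<open>Chosen so that the point dividing the segment from \<open>z t\<close> to
    \<open>v\<close> in the ratio t k : (1 - t k) has the same level under \<open>a\<close> as x + t
    (u - x); \<open>z t\<close> is then obtained by solving for the base point.\<close>
  define k where "k = (b - a \<bullet> u) / (b - a \<bullet> v)"
  have k: "k > 0" "k * (b - a \<bullet> v) = b - a \<bullet> u" using u v by (simp_all add: k_def)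
  define z where "z t = x + (1 / (1 - t * k)) *\<^sub>R (t *\<^sub>R (u - x) - (t * k) *\<^sub>R (v - x))" for t
  have ax: "a \<bullet> x = b"
    using x rel_interior_subset hull_subset[of e affine] hull by auto
  obtain r where r: "r > 0" "ball x r \<inter> affine hull e \<subseteq> e"
    using x by (auto simp: mem_rel_interior_ball)
  have "(z \<longlongrightarrow> x + (1 / (1 - 0 * k)) *\<^sub>R (0 *\<^sub>R (u - x) - (0 * k) *\<^sub>R (v - x))) (at_right 0)"
    unfolding z_def by (intro tendsto_intros) auto
  then have "\<forall>\<^sub>F t in at_right 0. dist (z t) x < r" using r(1) by (simp add: tendsto_iff)
  moreover have "\<forall>\<^sub>F t in at_right 0. t < 1 / k"
    using k by (intro eventually_at_rightI[of 0 "1 / k"]) auto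
  moreover have "\<forall>\<^sub>F t in at_right (0::real). 0 < t"
    by (simp add: eventually_at_filter)
  ultimately show ?thesis
  proof eventually_elim
    case (elim t)
    have s: "0 < t * k" "t * k < 1" using elim k(1) by (simp_all add: field_simps)
    have "a \<bullet> (t *\<^sub>R (u - x) - (t * k) *\<^sub>R (v - x)) = t * (k * (b - a \<bullet> v) - (b - a \<bullet> u))"
      by (simp add: inner_diff_right ax algebra_simps)
    then have "a \<bullet> z t = b" by (simp add: z_def inner_add_right ax k)
    then have "z t \<in> e" using elim r(2) hull by (auto simp: dist_commute)
    then have "z t - (t * k) *\<^sub>R (z t - v) \<in> interior K"
      using K v(1) s by (intro mem_interior_convex_shrink) auto
    also have "z t - (t * k) *\<^sub>R (z t - v) = (1 - t * k) *\<^sub>R (z t - x) + x + (t * k) *\<^sub>R (v - x)"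
      by (simp add: algebra_simps)
    also have "\<dots> = x + t *\<^sub>R (u - x)" using s by (simp add: z_def)
    finally show ?case .
  qed
qed

text \<open>A functional that attains its maximum over a convex set at a relative interior point is
  constant there, since the segment from any \<open>y\<close> to \<open>x\<close> can be prolonged
  beyond \<open>x\<close>. So \<open>e\<close> lies in the hyperplane, and the dimensions
  agree.\<close>

lemma affine_hull_supporting:
  fixes e :: "'a::euclidean_space set"
  assumes e: "convex e" "aff_dim e = int DIM('a) - 1" and x: "x \<in> rel_interior e"
    and a: "a \<noteq> 0" "\<And>y. y \<in> e \<Longrightarrow> a \<bullet> y \<le> a \<bullet> x"
  shows "affine hull e = {z. a \<bullet> z = a \<bullet> x}"
proof (rule affine_dim_equal)
  have "a \<bullet> y = a \<bullet> x" if y: "y \<in> e" for y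
  proof -
    obtain s where s: "s > 1" "(1 - s) *\<^sub>R y + s *\<^sub>R x \<in> e"
      using convex_rel_interior_iff[of e x] e x y by auto
    have "(1 - s) * (a \<bullet> y) + s * (a \<bullet> x) \<le> a \<bullet> x"
      using a(2)[OF s(2)] by (simp add: inner_add_right)
    then have "(s - 1) * (a \<bullet> x - a \<bullet> y) \<le> 0" by (simp add: algebra_simps)
    then show ?thesis using s(1) a(2)[OF y] by (simp add: mult_le_0_iff)
  qed
  then show "affine hull e \<subseteq> {z. a \<bullet> z = a \<bullet> x}"
    by (intro hull_minimal) (auto simp: affine_hyperplane)
  show "affine hull e \<noteq> {}" using x rel_interior_subset by fastforce
  show "aff_dim (affine hull e) = aff_dim {z. a \<bullet> z = a \<bullet> x}"
    using a(1) by (simp add: aff_dim_affine_hull e(2) aff_dim_hyperplane)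
qed (simp_all add: affine_hyperplane)

text \<open>Any hyperplane supporting \<open>S\<close> at a relative interior point of
  \<open>e\<close> must contain \<open>e\<close>. It is used with elements and with the domain in
  place of \<open>S\<close>.\<close>

lemma supporting_hyperplane_edge:
  fixes e S :: "'a::euclidean_space set"
  assumes e: "convex e" "aff_dim e = int DIM('a) - 1" and S: "convex S" "interior S \<noteq> {}"
    and sub: "e \<subseteq> frontier S"
  obtains a b where "norm a = 1" "affine hull e = {z. a \<bullet> z = b}"
    "\<And>y. y \<in> closure S \<Longrightarrow> a \<bullet> y \<le> b" "\<And>y. y \<in> interior S \<Longrightarrow> a \<bullet> y < b"
proof -
  have "e \<noteq> {}" using e(2) by (metis DIM_positive aff_dim_empty_eq diff_eq_eq
      add.left_inverse less_irrefl of_nat_0_eq_iff)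
  then obtain x where x: "x \<in> rel_interior e" using rel_interior_eq_empty[OF e(1)] by auto
  have rel: "rel_interior S = interior S" by (rule rel_interior_nonempty_interior[OF S(2)])
  have "x \<in> closure S" "x \<notin> rel_interior S"
    using x sub rel_interior_subset[of e] by (auto simp: rel frontier_def)
  then obtain a' where a': "a' \<noteq> 0" "\<And>y. y \<in> closure S \<Longrightarrow> a' \<bullet> x \<le> a' \<bullet> y"
    "\<And>y. y \<in> rel_interior S \<Longrightarrow> a' \<bullet> x < a' \<bullet> y"
    using supporting_hyperplane_relative_frontier[OF S(1)] by metis
  define a where "a = (- 1 / norm a') *\<^sub>R a'"
  have le: "a \<bullet> y \<le> a \<bullet> x" if "y \<in> closure S" for y
    using a'(1) a'(2)[OF that] by (simp add: a_def divide_right_mono)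
  have lt: "a \<bullet> y < a \<bullet> x" if "y \<in> interior S" for y
    using a'(1) a'(3)[of y] that by (simp add: a_def rel divide_strict_right_mono)
  have norm: "norm a = 1" using a'(1) by (simp add: a_def)
  have "affine hull e = {z. a \<bullet> z = a \<bullet> x}"
    using norm sub by (intro affine_hull_supporting[OF e x] le) (auto simp: frontier_def)
  with norm le lt show thesis by (intro that)
qed

lemma open_off_hyperplane:
  fixes a :: "'a::euclidean_space"
  assumes "open U" "U \<noteq> {}" "a \<noteq> 0"
  obtains u where "u \<in> U" "a \<bullet> u \<noteq> b"
  using assms interior_maximal[of U "{x. a \<bullet> x = b}"] interior_hyperplane[of a b] by blast

text \<open>The integral of a function that is not integrable is 0 by convention.\<close>

lemma integral_nonneg_gen:
  fixes f :: "'a::euclidean_space \<Rightarrow> real"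
  assumes "\<And>x. x \<in> S \<Longrightarrow> f x \<ge> 0"
  shows "integral S f \<ge> 0"
  using assms Henstock_Kurzweil_Integration.integral_nonneg[of f S]
  by (cases "f integrable_on S") (auto simp: not_integrable_integral)

lemma edge_integral_nonneg:
  assumes "\<And>x. f x \<ge> 0"
  shows "edge_integral e f \<ge> 0"
  unfolding edge_integral_def by (rule integral_nonneg_gen) (rule assms)

section \<open>Adjacency of elements and edges, and the trace inequality on an element\<close>

context
  fixes Om GD :: "(real^'n) set" and T :: "(real^'n) set set"
  assumes dom: "polytopal_domain Om" and sub: "subdivision Om T"
begin

lemma subdivision_element:
  assumes "K \<in> T"
  shows "compact K" "convex K" "closed K" "interior K \<noteq> {}" "closure (interior K) = K"
    "K \<subseteq> closure Om" "interior K \<subseteq> Om" "polytope K"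
proof -
  show K: "polytope K" "interior K \<noteq> {}" and "K \<subseteq> closure Om"
    using assms sub by (auto simp: subdivision_def)
  then show "compact K" "convex K" "closed K"
    by (simp_all add: polytope_imp_compact polytope_imp_convex polytope_imp_closed)
  then show "closure (interior K) = K"
    using K by (simp add: convex_closure_interior)
  have "interior (closure Om) = Om"
    using dom convex_interior_closure[of Om] by (simp add: polytopal_domain_def interior_open)
  then show "interior K \<subseteq> Om" using interior_mono[OF \<open>K \<subseteq> closure Om\<close>] by simp
qed

lemma elements_eq:
  assumes "K \<in> T" "K' \<in> T" "x \<in> interior K" "x \<in> interior K'"
  shows "K = K'"
  using assms sub unfolding subdivision_def by blast

text \<open>An open set that misses the interior of \<open>K'\<close> also misses its closure, which
  is \<open>K'\<close>. The point is that interior edges, defined by frontiers, turn out to be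
  intersections of convex sets.\<close>

lemma frontier_Int_elements:
  assumes "K \<in> T" "K' \<in> T" "K \<noteq> K'"
  shows "frontier K \<inter> frontier K' = K \<inter> K'"
proof -
  have *: "interior K \<inter> K' = {}" if "K \<in> T" "K' \<in> T" "K \<noteq> K'" for K K'
    using open_Int_closure_eq_empty[of "interior K" "interior K'"] that elements_eq[of K K']
    by (auto simp: subdivision_element)
  have "frontier K = K - interior K" if "K \<in> T" for K
    using subdivision_element[OF that] by (simp add: frontier_def)
  then show ?thesis using *[OF assms] *[of K' K] assms by auto
qed

text \<open>Both interiors contain the beginning of the segment from \<open>x\<close> to
  \<open>u\<close>: that of \<open>K'\<close> by convexity, that of \<open>K\<close> because
  \<open>K\<close> fills the side of the hyperplane on which \<open>u\<close> lies.\<close>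

lemma same_side_elements_eq:
  assumes K: "K \<in> T" "e \<subseteq> K" and hull: "affine hull e = {z. a \<bullet> z = b}"
    and x: "x \<in> rel_interior e" and K': "K' \<in> T" "x \<in> K'"
    and v: "v \<in> interior K" "a \<bullet> v < b" and u: "u \<in> interior K'" "a \<bullet> u < b"
  shows "K = K'"
proof -
  have "\<forall>\<^sub>F t in at_right 0. x + t *\<^sub>R (u - x) \<in> interior K"
    using subdivision_element[OF K(1)] by (intro convex_eventually_interior[OF _ K(2) hull x v u(2)]) simp
  moreover have "\<forall>\<^sub>F t in at_right 0. x + t *\<^sub>R (u - x) \<in> interior K'"
  proof (rule eventually_at_rightI)
    fix t :: real assume "t \<in> {0<..<1}"
    then have "x - t *\<^sub>R (x - u) \<in> interior K'"
      using subdivision_element[OF K'(1)] K' u by (intro mem_interior_convex_shrink) auto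
    then show "x + t *\<^sub>R (u - x) \<in> interior K'" by (simp add: algebra_simps)
  qed simp
  ultimately have "\<forall>\<^sub>F t in at_right (0::real). x + t *\<^sub>R (u - x) \<in> interior K \<inter> interior K'"
    by eventually_elim simp
  then obtain t where "x + t *\<^sub>R (u - x) \<in> interior K \<inter> interior K'"
    using eventually_happens[of _ "at_right (0::real)"] by auto
  then show ?thesis using elements_eq K(1) K'(1) by blast
qed

text \<open>Short steps from \<open>x\<close> towards \<open>v\<close> and towards its reflection 2
  x - v stay in \<open>K\<close> and \<open>K'\<close>, and \<open>x\<close> is their midpoint, so
  it lies in the convex domain. A further element at \<open>x\<close> has an interior point strictly
  on one side and thus coincides with the element on that side.\<close>

lemma opposite_sides_neighbourhood:
  assumes K: "K \<in> T" "e \<subseteq> K" and K': "K' \<in> T" "e \<subseteq> K'"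
    and hull: "affine hull e = {z. a \<bullet> z = b}" "a \<noteq> 0" and x: "x \<in> rel_interior e"
    and v: "v \<in> interior K" "a \<bullet> v < b" and v': "v' \<in> interior K'" "a \<bullet> v' > b"
  shows "x \<in> Om" and "\<And>L. L \<in> T \<Longrightarrow> x \<in> L \<Longrightarrow> L = K \<or> L = K'"
proof -
  have hull': "affine hull e = {z. - a \<bullet> z = - b}" using hull(1) by simp
  have ax: "a \<bullet> x = b"
    using x rel_interior_subset hull_subset[of e affine] hull by auto
  have "\<forall>\<^sub>F t in at_right 0. x + t *\<^sub>R (v - x) \<in> interior K"
    using subdivision_element[OF K(1)] by (intro convex_eventually_interior[OF _ K(2) hull(1) x v v(2)]) simp
  moreover have "\<forall>\<^sub>F t in at_right 0. x + t *\<^sub>R (2 *\<^sub>R x - v - x) \<in> interior K'"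
    using subdivision_element[OF K'(1)] v v' ax
    by (intro convex_eventually_interior[OF _ K'(2) hull' x v'(1)]) (auto simp: inner_diff_right)
  ultimately have "\<forall>\<^sub>F t in at_right (0::real). x \<in> Om"
  proof eventually_elim
    case (elim t)
    then have "x + t *\<^sub>R (v - x) \<in> Om" "x + t *\<^sub>R (2 *\<^sub>R x - v - x) \<in> Om"
      using subdivision_element(7) K(1) K'(1) by auto
    then have "(1/2) *\<^sub>R (x + t *\<^sub>R (v - x)) + (1/2) *\<^sub>R (x + t *\<^sub>R (2 *\<^sub>R x - v - x)) \<in> Om"
      using dom by (intro convexD) (auto simp: polytopal_domain_def)
    also have "(1/2) *\<^sub>R (x + t *\<^sub>R (v - x)) + (1/2) *\<^sub>R (x + t *\<^sub>R (2 *\<^sub>R x - v - x)) = x"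
      by (simp add: vec_eq_iff field_simps)
    finally show ?case .
  qed
  then show "x \<in> Om" using eventually_happens[of _ "at_right (0::real)"] by auto
  fix L assume L: "L \<in> T" "x \<in> L"
  obtain u where u: "u \<in> interior L" "a \<bullet> u \<noteq> b"
    using subdivision_element[OF L(1)] open_off_hyperplane[of "interior L" a b] hull(2) by auto
  then consider "a \<bullet> u < b" | "- a \<bullet> u < - b" by fastforce
  then show "L = K \<or> L = K'"
    by cases (use same_side_elements_eq[OF K hull(1) x L v u(1)]
        same_side_elements_eq[OF K' hull' x L v'(1) _ u(1)] v' in auto)
qed

text \<open>Distinct elements that share the edge cannot be on the same side of its hyperplane, so
  they are on opposite sides.\<close>

lemma interior_edge_neighbourhood:
  assumes K: "K \<in> T" "K' \<in> T" "K \<noteq> K'" and e: "e = frontier K \<inter> frontier K'"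
    and dim: "aff_dim e = int CARD('n) - 1" and x: "x \<in> rel_interior e"
  shows "x \<in> Om" and "\<And>L. L \<in> T \<Longrightarrow> x \<in> L \<Longrightarrow> L = K \<or> L = K'"
proof -
  have eK: "e \<subseteq> K" "e \<subseteq> K'" using frontier_Int_elements[OF K] e by auto
  obtain a b where hull: "affine hull e = {z. a \<bullet> z = b}" "a \<noteq> 0"
    using aff_dim_eq_hyperplane[of e] dim by auto
  have hull': "affine hull e = {z. - a \<bullet> z = - b}" using hull(1) by simp
  have xe: "x \<in> K" "x \<in> K'" using x rel_interior_subset[of e] eK by auto
  obtain v where v: "v \<in> interior K" "a \<bullet> v \<noteq> b"
    using subdivision_element[OF K(1)] open_off_hyperplane[of "interior K" a b] hull(2) by auto
  obtain v' where v': "v' \<in> interior K'" "a \<bullet> v' \<noteq> b"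
    using subdivision_element[OF K(2)] open_off_hyperplane[of "interior K'" a b] hull(2) by auto
  have "\<not> (a \<bullet> v < b \<and> a \<bullet> v' < b)" "\<not> (- a \<bullet> v < - b \<and> - a \<bullet> v' < - b)"
    using same_side_elements_eq[OF K(1) eK(1) hull(1) x K(2) xe(2) v(1) _ v'(1)]
      same_side_elements_eq[OF K(1) eK(1) hull' x K(2) xe(2) v(1) _ v'(1)] K(3) by blast+
  then consider "a \<bullet> v < b" "a \<bullet> v' > b" | "a \<bullet> v' < b" "a \<bullet> v > b"
    using v(2) v'(2) by fastforce
  then have "x \<in> Om \<and> (\<forall>L\<in>T. x \<in> L \<longrightarrow> L = K \<or> L = K')"
  proof cases
    case 1
    from opposite_sides_neighbourhood[OF K(1) eK(1) K(2) eK(2) hull x v(1) 1(1) v'(1) 1(2)]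
    show ?thesis by blast
  next
    case 2
    from opposite_sides_neighbourhood[OF K(2) eK(2) K(1) eK(1) hull x v'(1) 2(1) v(1) 2(2)]
    show ?thesis by blast
  qed
  then show "x \<in> Om" and "\<And>L. L \<in> T \<Longrightarrow> x \<in> L \<Longrightarrow> L = K \<or> L = K'" by auto
qed

lemma dg_edge:
  assumes "e \<in> dg_edges Om GD T"
  shows "compact e" "convex e" "aff_dim e = int DIM(real^'n) - 1" "rel_interior e \<noteq> {}"
proof -
  consider K K' where "K \<in> T" "K' \<in> T" "K \<noteq> K'" "e = frontier K \<inter> frontier K'"
      "aff_dim e = int CARD('n) - 1"
    | K where "K \<in> T" "e facet_of K"
    using assms by (auto simp: dg_edges_def interior_edges_def dirichlet_edges_def)
  then have *: "compact e \<and> convex e \<and> aff_dim e = int DIM(real^'n) - 1"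
  proof cases
    case 1
    then show ?thesis
      using subdivision_element(1,2)[OF 1(1)] subdivision_element(1,2)[OF 1(2)] frontier_Int_elements[OF 1(1-3)]
      by (auto intro: compact_Int convex_Int)
  next
    case 2
    have "polytope e"
      using 2 subdivision_element(8)[OF 2(1)] by (meson face_of_polytope_polytope facet_of_imp_face_of)
    moreover have "aff_dim K = int DIM(real^'n)"
      using subdivision_element(4)[OF 2(1)] by (rule aff_dim_nonempty_interior)
    ultimately show ?thesis
      using 2(2) by (auto simp: facet_of_def polytope_imp_compact polytope_imp_convex)
  qed
  have "e \<noteq> {}" using * by (metis DIM_positive aff_dim_empty_eq diff_eq_eq
      add.left_inverse less_irrefl of_nat_0_eq_iff)
  then show "rel_interior e \<noteq> {}" using rel_interior_eq_empty[of e] * by simp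
  show "compact e" "convex e" "aff_dim e = int DIM(real^'n) - 1" using * by auto
qed

lemma finite_edges: "finite (dg_edges Om GD T)"
proof -
  have fin: "finite T" using sub by (simp add: subdivision_def)
  have "interior_edges T \<subseteq> (\<lambda>(K, K'). frontier K \<inter> frontier K') ` (T \<times> T)"
    by (auto simp: interior_edges_def)
  moreover have "dirichlet_edges Om GD T \<subseteq> (\<Union>K\<in>T. {e. e facet_of K})"
    by (auto simp: dirichlet_edges_def)
  moreover have "finite (\<Union>K\<in>T. {e. e facet_of K})"
    using fin subdivision_element(8) by (auto intro: finite_polytope_facets)
  ultimately show ?thesis
    unfolding dg_edges_def using fin by (meson finite_SigmaI finite_UnI finite_imageI finite_subset)
qed

text \<open>A relative interior point of an interior edge lies in the open domain and in exactly two
  elements, which determine the edge; points of Dirichlet edges are outside the domain, so the two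
  kinds never mix. For two Dirichlet edges, the supporting hyperplane of the domain has both
  elements on the same side, so they coincide, and faces of one element whose relative interiors
  meet are equal.\<close>

lemma edges_disjoint:
  assumes e: "e \<in> dg_edges Om GD T" "e' \<in> dg_edges Om GD T"
    and x: "x \<in> rel_interior e" "x \<in> rel_interior e'"
  shows "e = e'"
proof -
  have int: "x \<in> Om \<and> (e' \<in> interior_edges T \<longrightarrow> e = e')"
    if e: "e \<in> interior_edges T" and x: "x \<in> rel_interior e" "x \<in> rel_interior e'" for e e'
  proof -
    obtain K K' where K: "K \<in> T" "K' \<in> T" "K \<noteq> K'" "e = frontier K \<inter> frontier K'"
      "aff_dim e = int CARD('n) - 1" using e by (auto simp: interior_edges_def)
    note nb = interior_edge_neighbourhood[OF K x(1)]
    have "e = e'" if e': "e' \<in> interior_edges T"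
    proof -
      obtain L L' where L: "L \<in> T" "L' \<in> T" "L \<noteq> L'" "e' = frontier L \<inter> frontier L'"
        using e' by (auto simp: interior_edges_def)
      then have "x \<in> L" "x \<in> L'"
        using x(2) rel_interior_subset[of e'] frontier_Int_elements by auto
      then have "{L, L'} = {K, K'}" using nb(2) L by blast
      then show ?thesis using K(4) L(4) by (auto simp: doubleton_eq_iff)
    qed
    with nb(1) show ?thesis by blast
  qed
  have Om: "open Om" "convex Om" "interior Om \<noteq> {}"
    using dom by (auto simp: polytopal_domain_def interior_open)
  have bd: "x \<notin> Om" if "e \<in> dirichlet_edges Om GD T" "x \<in> rel_interior e" for e
    using that rel_interior_subset[of e] Om(1)
    by (auto simp: dirichlet_edges_def frontier_def interior_open)
  show ?thesis
  proof (cases "e \<in> interior_edges T \<or> e' \<in> interior_edges T")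
    case True
    then show ?thesis using int[of e e'] int[of e' e] bd[of e] bd[of e'] e x
      by (auto simp: dg_edges_def)
  next
    case False
    then obtain K K' where K: "K \<in> T" "e facet_of K" "e \<subseteq> frontier Om"
      and K': "K' \<in> T" "e' facet_of K'"
      using e by (auto simp: dg_edges_def dirichlet_edges_def)
    have sub: "e \<subseteq> K" "e' \<subseteq> K'"
      using K(2) K'(2) by (auto dest: facet_of_imp_subset)
    obtain a b where ab: "affine hull e = {z. a \<bullet> z = b}" "\<And>y. y \<in> interior Om \<Longrightarrow> a \<bullet> y < b"
      using supporting_hyperplane_edge[OF dg_edge(2,3)[OF e(1)] Om(2,3) K(3)] by metis
    obtain v v' where v: "v \<in> interior K" "v' \<in> interior K'"
      using subdivision_element(4) K(1) K'(1) by blast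
    have "a \<bullet> v < b" "a \<bullet> v' < b"
      using v ab(2) subdivision_element(7) K(1) K'(1) Om(1) by (auto simp: interior_open)
    then have "K = K'"
      using same_side_elements_eq[OF K(1) sub(1) ab(1) x(1) K'(1)] x(2) v sub(2)
        rel_interior_subset[of e'] by blast
    then show ?thesis
      using face_of_eq[of e K e'] K(2) K'(2) x by (auto dest: facet_of_imp_face_of)
  qed
qed

text \<open>Justifies the definite description in \<open>opposite\<close>: an element whose frontier
  contains \<open>e\<close> contains a relative interior point of \<open>e\<close>, and only two
  elements do.\<close>

lemma opposite_element:
  assumes e: "e \<in> interior_edges T" and P: "P e \<in> T" "e \<subseteq> frontier (P e)"
  shows "opposite T P e \<in> T" "opposite T P e \<noteq> P e" "e \<subseteq> frontier (opposite T P e)"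
proof -
  obtain K K' where K: "K \<in> T" "K' \<in> T" "K \<noteq> K'" "e = frontier K \<inter> frontier K'"
    "aff_dim e = int CARD('n) - 1" using e by (auto simp: interior_edges_def)
  obtain x where x: "x \<in> rel_interior e" using dg_edge(4)[of e] e by (auto simp: dg_edges_def)
  have adj: "L = K \<or> L = K'" if "L \<in> T" "e \<subseteq> frontier L" for L
  proof -
    have "x \<in> L" using that x rel_interior_subset[of e] subdivision_element(3)[OF that(1)] frontier_subset_closed
      by blast
    then show ?thesis using interior_edge_neighbourhood(2)[OF K x that(1)] by simp
  qed
  have "\<exists>!L. L \<in> T \<and> L \<noteq> P e \<and> e \<subseteq> frontier L"
    using adj[OF P] adj K(1-4) by (metis inf.cobounded1 inf.cobounded2)
  from theI'[OF this] show "opposite T P e \<in> T" "opposite T P e \<noteq> P e"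
    "e \<subseteq> frontier (opposite T P e)"
    unfolding opposite_def by auto
qed

text \<open>A single integral over \<open>K\<close> bounds the sum over all edges, however many
  there are, because the cones are disjoint subsets of \<open>K\<close>: a ray from an interior
  point meets the frontier only once.\<close>

lemma trace_inequality:
  assumes K: "K \<in> T" and ball: "cball x0 \<delta> \<subseteq> K" "\<delta> > 0" and C: "C \<ge> 0"
    and g: "continuous_on UNIV g" "\<And>x. g x \<ge> 0"
    and ray: "\<And>z. ennreal (g z) \<le> ennreal C * (\<integral>\<^sup>+t. indicator {0<..<1} t *
        ennreal (t ^ (CARD('n) - 1) * g (x0 + t *\<^sub>R (z - x0))) \<partial>lborel)"
  shows "(\<Sum>e | e \<in> dg_edges Om GD T \<and> e \<subseteq> frontier K. edge_integral e g) \<le> C / \<delta> * integral K g"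
proof -
  define E where "E = {e \<in> dg_edges Om GD T. e \<subseteq> frontier K}"
  define cone where "cone e = open_cone x0 (rel_interior e)" for e
  have fin: "finite E" using finite_edges by (simp add: E_def)
  have x0: "x0 \<in> interior K" using ball by (meson ball_subset_cball centre_in_ball interior_maximal
      open_ball subset_trans subsetD)
  have [measurable]: "g \<in> borel_measurable borel" by (rule borel_measurable_continuous_onI[OF g(1)])
  have cont: "continuous_on S g" for S using g(1) continuous_on_subset by blast
  have nonneg: "edge_integral e g \<ge> 0" for e
    using g(2) by (rule edge_integral_nonneg)
  have facet: "ennreal (edge_integral e g) \<le> ennreal (C / \<delta>) *
      (\<integral>\<^sup>+x. indicator (cone e) x * ennreal (g x) \<partial>lborel) \<and> cone e \<in> sets borel" if e: "e \<in> E" for e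
  proof -
    have e': "e \<in> dg_edges Om GD T" "e \<subseteq> frontier K" using e by (auto simp: E_def)
    note ed = dg_edge[OF e'(1)]
    obtain a b where ab: "norm a = 1" "affine hull e = {z. a \<bullet> z = b}"
      "\<And>y. y \<in> closure K \<Longrightarrow> a \<bullet> y \<le> b"
      using supporting_hyperplane_edge[OF ed(2,3) subdivision_element(2,4)[OF K] e'(2)] by metis
    define d where "d = b - a \<bullet> x0"
    \<comment> \<open>The topmost point of the ball in direction \<open>a\<close> is still below the
      supporting hyperplane, so the cone has height at least \<delta>.\<close>
    have "x0 + \<delta> *\<^sub>R a \<in> K" using ball ab(1) by (auto simp: dist_norm)
    then have "a \<bullet> (x0 + \<delta> *\<^sub>R a) \<le> b" using ab(3) closure_subset by blast
    then have d: "\<delta> \<le> d" using ab(1) by (simp add: d_def inner_add_right norm_eq_1)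
    have meas: "cone e \<in> sets borel"
      unfolding cone_def using rel_interior_borel[of e] rel_interior_subset[of e]
        hull_subset[of e affine] ab(2) d ball(2)
      by (intro open_cone_borel[of _ a b]) (auto simp: d_def)
    have "ennreal (edge_integral e g) \<le> ennreal (1 / d) * (ennreal C *
      (\<integral>\<^sup>+x. indicator (cone e) x * ennreal (g x) \<partial>lborel))"
      unfolding cone_def using d ball(2)
      by (intro edge_integral_le_cone[OF ed(1,2) ab(2,1) d_def _ g ray]) auto
    also have "\<dots> = ennreal (C / d) * (\<integral>\<^sup>+x. indicator (cone e) x * ennreal (g x) \<partial>lborel)"
      using C d ball(2) by (simp add: mult.assoc[symmetric] flip: ennreal_mult)
    also have "\<dots> \<le> ennreal (C / \<delta>) * (\<integral>\<^sup>+x. indicator (cone e) x * ennreal (g x) \<partial>lborel)"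
      using C d ball(2) by (intro mult_right_mono ennreal_leI divide_left_mono) auto
    finally show ?thesis using meas by simp
  qed
  have frontier: "z \<in> K \<and> z \<notin> interior K" if "z \<in> rel_interior e" "e \<in> E" for z e
    using that rel_interior_subset[of e] subdivision_element(3)[OF K] by (auto simp: E_def frontier_def)
  have shrink: "x0 + t *\<^sub>R (z - x0) \<in> interior K" if "z \<in> K" "0 \<le> t" "t < 1" for z t
  proof -
    have "z - (1 - t) *\<^sub>R (z - x0) \<in> interior K"
      using that x0 subdivision_element(2)[OF K] by (intro mem_interior_convex_shrink) auto
    then show ?thesis by (simp add: algebra_simps)
  qed
  have disj: "e = e'" if E: "e \<in> E" "e' \<in> E" and x: "x \<in> cone e" "x \<in> cone e'" for e e' x
  proof -
    obtain t z where 1: "x = x0 + t *\<^sub>R (z - x0)" "0 < t" "z \<in> rel_interior e"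
      using x by (auto simp: cone_def open_cone_def)
    obtain t' z' where 2: "x = x0 + t' *\<^sub>R (z' - x0)" "0 < t'" "z' \<in> rel_interior e'"
      using x by (auto simp: cone_def open_cone_def)
    \<comment> \<open>With t < t' the point z' would lie strictly before z on the ray from
      \<open>x0\<close>, hence in the interior of \<open>K\<close>, although it is a frontier
      point.\<close>
    have ne: "\<not> t < t'" if "x0 + t *\<^sub>R (z - x0) = x0 + t' *\<^sub>R (z' - x0)" "0 < t" "0 < t'"
      "z \<in> K" "z' \<notin> interior K" for t t' :: real and z z'
    proof
      assume "t < t'"
      have "z' - x0 = (1 / t') *\<^sub>R (t' *\<^sub>R (z' - x0))" using that(3) by simp
      also have "t' *\<^sub>R (z' - x0) = t *\<^sub>R (z - x0)" using that(1) by simp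
      finally have "z' = x0 + (t / t') *\<^sub>R (z - x0)" by (simp add: algebra_simps)
      then show False using shrink[of z "t / t'"] that \<open>t < t'\<close> by simp
    qed
    have eq: "x0 + t *\<^sub>R (z - x0) = x0 + t' *\<^sub>R (z' - x0)" using 1 2 by simp
    have "t = t'"
      using ne[OF eq 1(2) 2(2)] ne[OF eq[symmetric] 2(2) 1(2)] frontier[OF 1(3) E(1)]
        frontier[OF 2(3) E(2)] by simp
    then have "z = z'" using 1 2 by simp
    then show ?thesis using edges_disjoint 1(3) 2(3) E by (auto simp: E_def)
  qed
  have "ennreal (\<Sum>e\<in>E. edge_integral e g) = (\<Sum>e\<in>E. ennreal (edge_integral e g))"
    using nonneg by (simp add: sum_ennreal)
  also have "\<dots> \<le> (\<Sum>e\<in>E. ennreal (C / \<delta>) * (\<integral>\<^sup>+x. indicator (cone e) x * ennreal (g x) \<partial>lborel))"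
    using facet by (intro sum_mono) blast
  also have "\<dots> = ennreal (C / \<delta>) * (\<integral>\<^sup>+x. (\<Sum>e\<in>E. indicator (cone e) x * ennreal (g x)) \<partial>lborel)"
  proof -
    have "(\<lambda>x. indicator (cone e) x * ennreal (g x)) \<in> borel_measurable lborel" if "e \<in> E" for e
      using facet[OF that] by (intro borel_measurable_times_ennreal borel_measurable_indicator) auto
    then show ?thesis by (simp add: nn_integral_sum sum_distrib_left)
  qed
  also have "\<dots> \<le> ennreal (C / \<delta>) * (\<integral>\<^sup>+x. indicator K x * ennreal (g x) \<partial>lborel)"
  proof (intro mult_left_mono nn_integral_mono)
    fix x
    show "(\<Sum>e\<in>E. indicator (cone e) x * ennreal (g x)) \<le> indicator K x * ennreal (g x)"
    proof (cases "\<exists>e\<in>E. x \<in> cone e")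
      case True
      then obtain e where e: "e \<in> E" "x \<in> cone e" by blast
      have "(\<Sum>e'\<in>E. indicator (cone e') x * ennreal (g x)) = (\<Sum>e'\<in>E. if e' = e then ennreal (g x) else 0)"
        using e disj by (intro sum.cong) (auto simp: indicator_def)
      moreover have "x \<in> K"
        using e frontier shrink interior_subset by (fastforce simp: cone_def open_cone_def)
      ultimately show ?thesis using fin e by simp
    next
      case False
      then have "(\<Sum>e\<in>E. indicator (cone e) x * ennreal (g x)) = 0"
        by (intro sum.neutral) auto
      then show ?thesis by simp
    qed
  qed simp
  also have "\<dots> = ennreal (C / \<delta> * integral K g)"
    using nn_integral_compact(2)[OF subdivision_element(1)[OF K] cont] C ball(2) g(2)
    by (simp flip: ennreal_mult')
  finally show ?thesis
    using C ball(2) g(2) integral_nonneg_gen[of K g]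
    unfolding E_def by (subst (asm) ennreal_le_iff) auto
qed

end

subsection \<open>The elasticity tensor\<close>

definition tensor_apply :: "'n::finite tensor4 \<Rightarrow> real^'n^'n \<Rightarrow> real^'n^'n" where
  "tensor_apply C M = (\<chi> i j. \<Sum>k\<in>UNIV. \<Sum>l\<in>UNIV. C i j k l * M $ k $ l)"

lemma stress_eq: "stress C u x = tensor_apply (C x) (strain u x)"
  by (simp add: stress_def tensor_apply_def)

lemma linear_tensor_apply: "linear (tensor_apply C)"
  by (rule linearI)
    (simp_all add: tensor_apply_def vec_eq_iff algebra_simps sum.distrib sum_distrib_left)

lemma tensor_apply_inner:
  "tensor_apply C M \<bullet> N = (\<Sum>i\<in>UNIV. \<Sum>j\<in>UNIV. \<Sum>k\<in>UNIV. \<Sum>l\<in>UNIV. C i j k l * N $ i $ j * M $ k $ l)"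
  by (simp add: tensor_apply_def inner_vec_def sum_distrib_left mult_ac)

lemma elasticity_tensorD:
  assumes "elasticity_tensor C"
  shows "transpose (tensor_apply C M) = tensor_apply C M"
    and "tensor_apply C M \<bullet> N = tensor_apply C N \<bullet> M"
    and "transpose M = M \<Longrightarrow> 0 \<le> tensor_apply C M \<bullet> M"
proof -
  have sym: "C i j k l = C j i k l" "C i j k l = C k l i j" for i j k l
    using assms by (auto simp: elasticity_tensor_def)
  show "transpose (tensor_apply C M) = tensor_apply C M"
    unfolding tensor_apply_def transpose_def vec_eq_iff vec_lambda_beta
    by (intro allI sum.cong refl) (simp add: sym(1))
  \<comment> \<open>Moves the third summation index past the first two; applied twice it exchanges
    the index pairs, as the major symmetry requires.\<close>
  have rot: "(\<Sum>i\<in>UNIV. \<Sum>j\<in>UNIV. \<Sum>k\<in>UNIV. g i j k) = (\<Sum>k\<in>UNIV. \<Sum>i\<in>UNIV. \<Sum>j\<in>UNIV. g i j k)"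
    for g :: "'a \<Rightarrow> 'a \<Rightarrow> 'a \<Rightarrow> real"
  proof -
    have "(\<Sum>i\<in>UNIV. \<Sum>j\<in>UNIV. \<Sum>k\<in>UNIV. g i j k) = (\<Sum>i\<in>UNIV. \<Sum>k\<in>UNIV. \<Sum>j\<in>UNIV. g i j k)"
      by (intro sum.cong refl sum.swap)
    also have "\<dots> = (\<Sum>k\<in>UNIV. \<Sum>i\<in>UNIV. \<Sum>j\<in>UNIV. g i j k)" by (rule sum.swap)
    finally show ?thesis .
  qed
  have "tensor_apply C M \<bullet> N
      = (\<Sum>k\<in>UNIV. \<Sum>i\<in>UNIV. \<Sum>j\<in>UNIV. \<Sum>l\<in>UNIV. C i j k l * N $ i $ j * M $ k $ l)"
    unfolding tensor_apply_inner by (rule rot)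
  also have "\<dots> = (\<Sum>k\<in>UNIV. \<Sum>l\<in>UNIV. \<Sum>i\<in>UNIV. \<Sum>j\<in>UNIV. C i j k l * N $ i $ j * M $ k $ l)"
    by (intro sum.cong refl rot)
  also have "\<dots> = tensor_apply C N \<bullet> M"
    unfolding tensor_apply_inner
  proof (intro sum.cong refl)
    fix k l i j
    show "C i j k l * N $ i $ j * M $ k $ l = C k l i j * M $ k $ l * N $ i $ j"
      by (simp add: sym(2)[of i j k l])
  qed
  finally show "tensor_apply C M \<bullet> N = tensor_apply C N \<bullet> M" .
  show "0 \<le> tensor_apply C M \<bullet> M" if "transpose M = M"
  proof (cases "M = 0")
    case False
    then show ?thesis
      using assms that by (simp add: elasticity_tensor_def tensor_apply_inner less_imp_le)
  qed simp
qed

text \<open>The Cauchy--Schwarz inequality for the form \<open>tensor_apply C M \<bullet> N\<close> with \<open>N = tensor_apply C M\<close>,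
  obtained by expanding the energy of \<open>M - N /\<^sub>R B\<close>.\<close>

lemma tensor_apply_bound:
  fixes C :: "'n::finite tensor4"
  assumes C: "elasticity_tensor C"
  obtains B where "B > 0"
    "\<And>M. transpose M = M \<Longrightarrow> (norm (tensor_apply C M))\<^sup>2 \<le> B * (tensor_apply C M \<bullet> M)"
proof -
  let ?L = "tensor_apply C"
  obtain B where B: "B > 0" "\<And>M. norm (?L M) \<le> B * norm M"
    using linear_bounded_pos[OF linear_tensor_apply] by blast
  have "(norm (?L M))\<^sup>2 \<le> B * (?L M \<bullet> M)" if M: "transpose M = M" for M
  proof -
    define N where "N = ?L M"
    \<comment> \<open>The minimiser of B t^2 - 2 t, the coefficient of the squared norm of
      \<open>N\<close> in the expanded energy.\<close>
    define t where "t = 1 / B"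
    have tr: "transpose (M - t *\<^sub>R N) = M - t *\<^sub>R N"
      using elasticity_tensorD(1)[OF C, of M] M
      by (simp add: N_def transpose_def vec_eq_iff)
    have LN: "?L N \<bullet> M = N \<bullet> N"
      using elasticity_tensorD(2)[OF C, of N M] by (simp add: N_def)
    have "0 \<le> ?L (M - t *\<^sub>R N) \<bullet> (M - t *\<^sub>R N)" by (rule elasticity_tensorD(3)[OF C tr])
    also have "?L (M - t *\<^sub>R N) = N - t *\<^sub>R ?L N"
      by (simp add: linear_diff[OF linear_tensor_apply] linear_scale[OF linear_tensor_apply] N_def)
    also have "(N - t *\<^sub>R ?L N) \<bullet> (M - t *\<^sub>R N) = N \<bullet> M - 2 * t * (N \<bullet> N) + t\<^sup>2 * (?L N \<bullet> N)"
      using LN by (simp add: inner_diff_left inner_diff_right power2_eq_square algebra_simps)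
    also have "?L N \<bullet> N \<le> B * (N \<bullet> N)"
    proof -
      have "?L N \<bullet> N \<le> norm (?L N) * norm N" by (rule norm_cauchy_schwarz)
      also have "\<dots> \<le> B * norm N * norm N" using B(2) by (intro mult_right_mono) auto
      finally show ?thesis by (simp add: dot_square_norm power2_eq_square)
    qed
    finally have "0 \<le> N \<bullet> M - 2 * t * (N \<bullet> N) + t\<^sup>2 * (B * (N \<bullet> N))"
      by (simp add: mult_left_mono)
    then have "0 \<le> N \<bullet> M - (N \<bullet> N) / B"
      using B(1) by (simp add: t_def power2_eq_square field_simps)
    then show ?thesis
      using B(1) by (simp add: N_def dot_square_norm field_simps)
  qed
  with B(1) show thesis by (rule that)
qed

text \<open>The family may be infinite, so no maximum over all its elements can be taken. But the
  finitely many frontiers of one mesh form a null set, so the interior of every element of any other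
  mesh meets the interior of one of its elements; as \<open>C\<close> is constant on both interiors,
  the values agree.\<close>

lemma tensor_field_bound:
  fixes Om :: "(real^'n) set" and C :: "real^'n \<Rightarrow> 'n tensor4" and F :: "(real^'n) set set set"
  assumes dom: "polytopal_domain Om" and C: "\<forall>x\<in>Om. elasticity_tensor (C x)"
    and sub: "\<forall>T\<in>F. subdivision Om T" and const: "\<forall>T\<in>F. \<forall>K\<in>T. C constant_on interior K"
  obtains B where "B > 0" "\<And>T K x M. T \<in> F \<Longrightarrow> K \<in> T \<Longrightarrow> x \<in> interior K \<Longrightarrow> transpose M = M \<Longrightarrow>
    (norm (tensor_apply (C x) M))\<^sup>2 \<le> B * (tensor_apply (C x) M \<bullet> M)"
proof (cases "F = {}")
  case True
  then show thesis using that[of 1] by simp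
next
  case False
  then obtain T0 where T0: "T0 \<in> F" by blast
  have fin: "finite T0" using sub T0 by (simp add: subdivision_def)
  have "\<exists>B>0. \<forall>x\<in>interior K. \<forall>M. transpose M = M \<longrightarrow>
      (norm (tensor_apply (C x) M))\<^sup>2 \<le> B * (tensor_apply (C x) M \<bullet> M)" if K: "K \<in> T0" for K
  proof -
    obtain y where y: "y \<in> interior K" using subdivision_element(4)[OF dom sub[rule_format, OF T0] K] by blast
    then have "elasticity_tensor (C y)"
      using C subdivision_element(7)[OF dom sub[rule_format, OF T0] K] by blast
    moreover have "C x = C y" if "x \<in> interior K" for x
    proof -
      have "C constant_on interior K" using const T0 K by blast
      then show ?thesis using y that unfolding constant_on_def by metis
    qed
    ultimately show ?thesis using tensor_apply_bound by metis
  qed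
  then obtain B where B: "\<And>K. K \<in> T0 \<Longrightarrow> B K > 0"
    "\<And>K x M. K \<in> T0 \<Longrightarrow> x \<in> interior K \<Longrightarrow> transpose M = M \<Longrightarrow>
      (norm (tensor_apply (C x) M))\<^sup>2 \<le> B K * (tensor_apply (C x) M \<bullet> M)" by metis
  show thesis
  proof (rule that[of "1 + sum B T0"])
    show "0 < 1 + sum B T0" using B(1) by (intro add_pos_nonneg sum_nonneg) (auto simp: less_imp_le)
    fix T K x and M :: "real^'n^'n"
    assume T: "T \<in> F" and K: "K \<in> T" and x: "x \<in> interior K" and M: "transpose M = M"
    note el = subdivision_element[OF dom sub[rule_format, OF T] K]
    have "\<exists>K0\<in>T0. \<exists>y\<in>interior K. y \<in> interior K0"
    proof (rule ccontr)
      assume disj: "\<not> (\<exists>K0\<in>T0. \<exists>y\<in>interior K. y \<in> interior K0)"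
      have cover: "interior K \<subseteq> \<Union>T0"
        using el(6) interior_subset[of K] sub T0 by (auto simp: subdivision_def)
      have "interior K \<subseteq> \<Union>(frontier ` T0)"
      proof
        fix y assume y: "y \<in> interior K"
        then obtain K0 where "K0 \<in> T0" "y \<in> K0" using cover by blast
        then show "y \<in> \<Union>(frontier ` T0)"
          using disj y closure_subset[of K0] by (auto simp: frontier_def)
      qed
      moreover have "negligible (\<Union>(frontier ` T0))"
        using fin subdivision_element(2)[OF dom sub[rule_format, OF T0]]
        by (intro negligible_Union) (auto intro: negligible_convex_frontier)
      ultimately have "negligible (interior K)" by (rule negligible_subset[rotated])
      then show False using el(4) open_not_negligible[of "interior K"] by simp
    qed
    then obtain K0 y where K0: "K0 \<in> T0" "y \<in> interior K" "y \<in> interior K0" by blast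
    have "C constant_on interior K" using const T K by blast
    then have "C x = C y" using x K0(2) unfolding constant_on_def by metis
    then have "(norm (tensor_apply (C x) M))\<^sup>2 \<le> B K0 * (tensor_apply (C x) M \<bullet> M)"
      using B(2)[OF K0(1,3) M] by simp
    also have "\<dots> \<le> (1 + sum B T0) * (tensor_apply (C x) M \<bullet> M)"
    proof (rule mult_right_mono)
      show "B K0 \<le> 1 + sum B T0"
        using member_le_sum[of K0 T0 B] K0(1) fin B(1) by (fastforce simp: less_imp_le)
      show "0 \<le> tensor_apply (C x) M \<bullet> M"
        using el(7) x C M by (intro elasticity_tensorD(3)) auto
    qed
    finally show "(norm (tensor_apply (C x) M))\<^sup>2 \<le> (1 + sum B T0) * (tensor_apply (C x) M \<bullet> M)" .
  qed
qed

subsection \<open>Restrictions of polynomials to lines and traces\<close>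

text \<open>Total degree seen through restrictions to lines: only values along rays from an apex
  enter the estimates.\<close>

definition line_poly :: "nat \<Rightarrow> ('a::real_vector \<Rightarrow> real) \<Rightarrow> bool" where
  "line_poly r f \<longleftrightarrow> (\<forall>a v. \<exists>p. degree p \<le> r \<and> (\<forall>t. f (a + t *\<^sub>R v) = poly p t))"

lemma line_poly_const: "line_poly r (\<lambda>x. c)"
  unfolding line_poly_def by (intro allI exI[of _ "[:c:]"]) simp

lemma line_poly_component: "line_poly 1 (\<lambda>x::real^'n. x $ i)"
  unfolding line_poly_def
proof (intro allI)
  fix a v :: "real^'n"
  show "\<exists>p. degree p \<le> 1 \<and> (\<forall>t. (a + t *\<^sub>R v) $ i = poly p t)"
    by (intro exI[of _ "[:a $ i, v $ i:]"]) simp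
qed

lemma line_poly_add: "line_poly r f \<Longrightarrow> line_poly r g \<Longrightarrow> line_poly r (\<lambda>x. f x + g x)"
  unfolding line_poly_def by (metis degree_add_le poly_add)

lemma line_poly_mult: "line_poly r f \<Longrightarrow> line_poly s g \<Longrightarrow> line_poly (r + s) (\<lambda>x. f x * g x)"
  unfolding line_poly_def by (metis degree_mult_le add_mono order_trans poly_mult)

lemma line_poly_cmult: "line_poly r f \<Longrightarrow> line_poly r (\<lambda>x. c * f x)"
  using line_poly_mult[OF line_poly_const[of 0 c]] by simp

lemma line_poly_sum: "(\<And>i. i \<in> I \<Longrightarrow> line_poly r (f i)) \<Longrightarrow> line_poly r (\<lambda>x. \<Sum>i\<in>I. f i x)"
  by (induction I rule: infinite_finite_induct) (auto intro: line_poly_const line_poly_add)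

lemma line_poly_mono: "line_poly r f \<Longrightarrow> r \<le> s \<Longrightarrow> line_poly s f"
  unfolding line_poly_def by (meson order_trans)

text \<open>Derivatives are assigned the degree r rather than r - 1; this crude bound is stable
  under the product rule, constants included, and keeps the order r^2.\<close>

definition line_poly_deriv :: "nat \<Rightarrow> ('a::real_normed_vector \<Rightarrow> real) \<Rightarrow> bool" where
  "line_poly_deriv r f \<longleftrightarrow> line_poly r f \<and> (\<exists>f'. (\<forall>x. (f has_derivative f' x) (at x)) \<and>
     (\<forall>v. continuous_on UNIV (\<lambda>x. f' x v) \<and> line_poly r (\<lambda>x. f' x v)))"

lemma line_poly_derivI:
  assumes "line_poly r f" "\<And>x. (f has_derivative f' x) (at x)"
    "\<And>v. continuous_on UNIV (\<lambda>x. f' x v)" "\<And>v. line_poly r (\<lambda>x. f' x v)"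
  shows "line_poly_deriv r f"
  using assms by (auto simp: line_poly_deriv_def)

lemma line_poly_derivE:
  assumes "line_poly_deriv r f"
  obtains f' where "line_poly r f" "\<And>x. (f has_derivative f' x) (at x)" "continuous_on UNIV f"
    "\<And>v. continuous_on UNIV (\<lambda>x. f' x v)" "\<And>v. line_poly r (\<lambda>x. f' x v)"
  using assms unfolding line_poly_deriv_def
  by (metis has_derivative_continuous_on has_derivative_at_withinI)

lemma line_poly_deriv_const: "line_poly_deriv r (\<lambda>x. c)"
  by (rule line_poly_derivI[where f' = "\<lambda>x v. 0"]) (auto intro: line_poly_const)

lemma line_poly_deriv_component: "line_poly_deriv 1 (\<lambda>x::real^'n. x $ i)"
  by (rule line_poly_derivI[where f' = "\<lambda>x v. v $ i"])
    (auto intro: line_poly_const line_poly_component[simplified] bounded_linear_imp_has_derivative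
      bounded_linear_vec_nth)

lemma line_poly_deriv_add:
  assumes "line_poly_deriv r f" "line_poly_deriv r g"
  shows "line_poly_deriv r (\<lambda>x. f x + g x)"
proof -
  obtain f' g' where "line_poly r f" "\<And>x. (f has_derivative f' x) (at x)"
      "\<And>v. continuous_on UNIV (\<lambda>x. f' x v)" "\<And>v. line_poly r (\<lambda>x. f' x v)"
    "line_poly r g" "\<And>x. (g has_derivative g' x) (at x)"
      "\<And>v. continuous_on UNIV (\<lambda>x. g' x v)" "\<And>v. line_poly r (\<lambda>x. g' x v)"
    using line_poly_derivE[OF assms(1)] line_poly_derivE[OF assms(2)] by metis
  then show ?thesis
    by (intro line_poly_derivI[where f' = "\<lambda>x v. f' x v + g' x v"])
      (auto intro!: has_derivative_add continuous_intros line_poly_add)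
qed

lemma line_poly_deriv_mult:
  assumes "line_poly_deriv r f" "line_poly_deriv s g"
  shows "line_poly_deriv (r + s) (\<lambda>x. f x * g x)"
proof -
  obtain f' where f: "line_poly r f" "\<And>x. (f has_derivative f' x) (at x)" "continuous_on UNIV f"
      "\<And>v. continuous_on UNIV (\<lambda>x. f' x v)" "\<And>v. line_poly r (\<lambda>x. f' x v)"
    using line_poly_derivE[OF assms(1)] by metis
  obtain g' where g: "line_poly s g" "\<And>x. (g has_derivative g' x) (at x)" "continuous_on UNIV g"
      "\<And>v. continuous_on UNIV (\<lambda>x. g' x v)" "\<And>v. line_poly s (\<lambda>x. g' x v)"
    using line_poly_derivE[OF assms(2)] by metis
  show ?thesis
    using f g by (intro line_poly_derivI[where f' = "\<lambda>x v. f x * g' x v + f' x v * g x"])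
      (auto intro!: has_derivative_mult continuous_intros line_poly_add line_poly_mult)
qed

lemma line_poly_deriv_mono: "line_poly_deriv r f \<Longrightarrow> r \<le> s \<Longrightarrow> line_poly_deriv s f"
  unfolding line_poly_deriv_def using line_poly_mono by blast

lemma line_poly_deriv_sum:
  "(\<And>i. i \<in> I \<Longrightarrow> line_poly_deriv r (f i)) \<Longrightarrow> line_poly_deriv r (\<lambda>x. \<Sum>i\<in>I. f i x)"
  by (induction I rule: infinite_finite_induct)
    (auto intro: line_poly_deriv_const line_poly_deriv_add)

lemma line_poly_deriv_power: "line_poly_deriv r f \<Longrightarrow> line_poly_deriv (k * r) (\<lambda>x. f x ^ k)"
  by (induction k) (auto intro: line_poly_deriv_const line_poly_deriv_mult)

lemma line_poly_deriv_prod: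
  "(\<And>i. i \<in> I \<Longrightarrow> line_poly_deriv (k i) (f i)) \<Longrightarrow> line_poly_deriv (\<Sum>i\<in>I. k i) (\<lambda>x. \<Prod>i\<in>I. f i x)"
  by (induction I rule: infinite_finite_induct)
    (auto intro: line_poly_deriv_const line_poly_deriv_mult)

lemma polynomials_line_poly_deriv:
  assumes "p \<in> polynomials r"
  shows "line_poly_deriv r p"
proof -
  obtain c where p: "p = (\<lambda>x. \<Sum>k | (\<Sum>i\<in>UNIV. k i) \<le> r. c k * (\<Prod>i\<in>UNIV. x $ i ^ k i))"
    using assms by (auto simp: polynomials_def)
  have "line_poly_deriv r (\<lambda>x. c k * (\<Prod>i\<in>UNIV. x $ i ^ k i))" if "(\<Sum>i\<in>UNIV. k i) \<le> r"
    for k :: "'a \<Rightarrow> nat"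
  proof -
    have "line_poly_deriv (k i) (\<lambda>x::real^'a. x $ i ^ k i)" for i
      using line_poly_deriv_power[OF line_poly_deriv_component[of i], of "k i"] by simp
    then have "line_poly_deriv (0 + (\<Sum>i\<in>UNIV. k i)) (\<lambda>x. c k * (\<Prod>i\<in>UNIV. x $ i ^ k i))"
      by (intro line_poly_deriv_mult line_poly_deriv_const line_poly_deriv_prod)
    with that show ?thesis using line_poly_deriv_mono by simp
  qed
  then show ?thesis unfolding p by (intro line_poly_deriv_sum) auto
qed

text \<open>Replaces \<open>w\<close> and its strain, which are controlled only in the interior of
  the element, by functions that are continuous on the whole space; the derivative at an interior
  point sees only the polynomial.\<close>

lemma dg_space_element:
  fixes w :: "real^'n \<Rightarrow> real^'n"
  assumes w: "w \<in> dg_space T r" and K: "K \<in> T"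
  shows "\<exists>p E. continuous_on UNIV p \<and> continuous_on UNIV E \<and> (\<forall>x. transpose (E x) = E x) \<and>
    (\<forall>i j. line_poly r (\<lambda>x. E x $ i $ j)) \<and> (\<forall>x\<in>interior K. w x = p x \<and> strain w x = E x)"
proof -
  obtain p where p: "\<And>i. (\<lambda>x. p x $ i) \<in> polynomials r" "\<And>x. x \<in> interior K \<Longrightarrow> w x = p x"
    using w K unfolding dg_space_def by blast
  have "\<exists>f'. (\<forall>x. ((\<lambda>x. p x $ i) has_derivative f' x) (at x)) \<and> continuous_on UNIV (\<lambda>x. p x $ i) \<and>
     (\<forall>v. continuous_on UNIV (\<lambda>x. f' x v) \<and> line_poly r (\<lambda>x. f' x v))" for i
    using polynomials_line_poly_deriv[OF p(1)[of i]] by (rule line_poly_derivE) blast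
  then obtain f' where f': "\<And>i x. ((\<lambda>x. p x $ i) has_derivative f' i x) (at x)"
    "\<And>i. continuous_on UNIV (\<lambda>x. p x $ i)" "\<And>i v. continuous_on UNIV (\<lambda>x. f' i x v)"
    "\<And>i v. line_poly r (\<lambda>x. f' i x v)" by metis
  define E where "E x = (\<chi> i j. (1/2) * (f' i x (axis j 1) + f' j x (axis i 1)))" for x
  have jac: "jacobian w (at x) = (\<chi> i j. f' i x (axis j 1))" if x: "x \<in> interior K" for x
  proof -
    have "(p has_derivative (\<lambda>v. \<chi> i. f' i x v)) (at x)"
      using f'(1) by (simp add: has_derivative_componentwise_within[of p] Basis_vec_def inner_axis)
    then have "(w has_derivative (\<lambda>v. \<chi> i. f' i x v)) (at x)"
      by (rule has_derivative_transform_within_open[OF _ open_interior x]) (simp add: p(2))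
    then have "frechet_derivative w (at x) = (\<lambda>v. \<chi> i. f' i x v)"
      by (rule frechet_derivative_at[symmetric])
    then show ?thesis by (simp add: jacobian_def matrix_def)
  qed
  show ?thesis
  proof (intro exI[of _ p] exI[of _ E] conjI allI ballI)
    show "continuous_on UNIV p"
      using continuous_on_vec_lambda[of UNIV "\<lambda>i x. p x $ i"] f'(2) by simp
    show "continuous_on UNIV E" unfolding E_def
      by (intro continuous_on_vec_lambda continuous_intros f'(3))
    fix x i j
    show "transpose (E x) = E x"
      by (simp add: E_def transpose_def vec_eq_iff add.commute)
    show "line_poly r (\<lambda>x. E x $ i $ j)"
      unfolding E_def by (simp only: vec_lambda_beta) (intro line_poly_cmult line_poly_add f'(4))
    assume x: "x \<in> interior K"
    show "w x = p x" by (rule p(2)[OF x])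
    show "strain w x = E x"
      using jac[OF x] by (simp add: strain_def E_def transpose_def vec_eq_iff)
  qed
qed

text \<open>The squared norm is the sum of the squared entries, and each entry is a polynomial along
  the ray whose value at t = 1 is that at \<open>z\<close>. This supplies the ray hypothesis of
  \<open>trace_inequality\<close>.\<close>

lemma line_poly_ray_bound:
  fixes S :: "'a::real_normed_vector \<Rightarrow> real^'m^'n"
  assumes S: "\<And>i j. line_poly r (\<lambda>x. S x $ i $ j)" and n: "n \<ge> 1"
  shows "ennreal ((norm (S z))\<^sup>2) \<le> ennreal (real ((r + 1) * (r + n))) *
    (\<integral>\<^sup>+t. indicator {0<..<1} t *
      ennreal (t ^ (n - 1) * (norm (S (x0 + t *\<^sub>R (z - x0))))\<^sup>2) \<partial>lborel)"
proof -
  let ?M = "ennreal (real ((r + 1) * (r + n)))"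
  have "\<exists>P. degree P \<le> r \<and> (\<forall>t. S (x0 + t *\<^sub>R (z - x0)) $ i $ j = poly P t)" for i j
    using S[of i j] by (simp add: line_poly_def)
  then obtain P where P: "\<And>i j. degree (P i j) \<le> r"
    "\<And>i j t. S (x0 + t *\<^sub>R (z - x0)) $ i $ j = poly (P i j) t" by metis
  have P1: "S z $ i $ j = poly (P i j) 1" for i j using P(2)[of 1 i j] by simp
  have norm2: "(norm A)\<^sup>2 = (\<Sum>i\<in>UNIV. \<Sum>j\<in>UNIV. (A $ i $ j)\<^sup>2)" for A :: "real^'m^'n"
    unfolding power2_norm_eq_inner inner_vec_def by (simp add: power2_eq_square)
  let ?h = "\<lambda>i j t. indicator {0<..<1} t * ennreal (t ^ (n - 1) * (poly (P i j) t)\<^sup>2)"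
  have "(\<lambda>t. t ^ (n - 1) * (poly (P i j) t)\<^sup>2) \<in> borel_measurable borel" for i j
    by (intro borel_measurable_continuous_onI continuous_intros)
  then have [measurable]: "?h i j \<in> borel_measurable borel" for i j
    by (intro borel_measurable_times_ennreal measurable_compose[OF _ measurable_ennreal]) auto
  have "ennreal ((norm (S z))\<^sup>2) = (\<Sum>i\<in>UNIV. \<Sum>j\<in>UNIV. ennreal ((poly (P i j) 1)\<^sup>2))"
    by (simp add: norm2 P1 sum_ennreal sum_nonneg)
  also have "\<dots> \<le> (\<Sum>i\<in>UNIV. \<Sum>j\<in>UNIV. ?M * (\<integral>\<^sup>+t. ?h i j t \<partial>lborel))"
    by (intro sum_mono poly_endpoint_bound_nn P n)
  also have "\<dots> = ?M * (\<integral>\<^sup>+t. (\<Sum>i\<in>UNIV. \<Sum>j\<in>UNIV. ?h i j t) \<partial>lborel)"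
  proof -
    have "(\<integral>\<^sup>+t. (\<Sum>i\<in>UNIV. \<Sum>j\<in>UNIV. ?h i j t) \<partial>lborel)
        = (\<Sum>i\<in>UNIV. \<integral>\<^sup>+t. (\<Sum>j\<in>UNIV. ?h i j t) \<partial>lborel)"
      by (rule nn_integral_sum) measurable
    also have "\<dots> = (\<Sum>i\<in>UNIV. \<Sum>j\<in>UNIV. \<integral>\<^sup>+t. ?h i j t \<partial>lborel)"
      by (intro sum.cong refl nn_integral_sum) measurable
    finally show ?thesis by (simp only: sum_distrib_left)
  qed
  also have "(\<lambda>t. \<Sum>i\<in>UNIV. \<Sum>j\<in>UNIV. ?h i j t) = (\<lambda>t. indicator {0<..<1} t *
      ennreal (t ^ (n - 1) * (norm (S (x0 + t *\<^sub>R (z - x0))))\<^sup>2))"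
    by (rule ext) (auto simp: norm2 P(2) indicator_def sum_ennreal sum_nonneg sum_distrib_left)
  finally show ?thesis .
qed

text \<open>A convex set with nonempty interior is in the closure of its interior, so the limit from
  the interior exists and is unique also on the frontier.\<close>

lemma element_trace_eq:
  assumes K: "convex K" "interior K \<noteq> {}" and x: "x \<in> K" and g: "continuous_on UNIV g"
    and eq: "\<And>y. y \<in> interior K \<Longrightarrow> f y = g y"
  shows "element_trace K f x = g x"
  unfolding element_trace_def
proof (rule tendsto_Lim)
  have "x \<in> closure (interior K)"
    using x K closure_subset by (auto simp: convex_closure_interior)
  then have "x islimpt interior K"
    using interior_limit_point[of x "interior K"] by (auto simp: closure_def)
  then show "at x within interior K \<noteq> bot" by (simp add: trivial_limit_within)
  have "(g \<longlongrightarrow> g x) (at x within interior K)"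
    using g by (meson UNIV_I continuous_on_def subset_UNIV tendsto_within_subset)
  then show "(f \<longlongrightarrow> g x) (at x within interior K)"
    by (rule tendsto_cong[THEN iffD1, rotated])
      (auto simp: eventually_at_filter eq)
qed

text \<open>The length can be read off only once the definite description is known to be met by a
  unique vector. Any candidate supports \<open>K\<close> along \<open>e\<close>, so its hyperplane
  is the affine hull of \<open>e\<close> and it equals the supporting normal up to sign; an interior
  point of \<open>K\<close> fixes the sign.\<close>

lemma norm_outward_normal:
  fixes K e :: "(real^'n) set"
  assumes K: "convex K" "interior K \<noteq> {}" and e: "convex e" "aff_dim e = int DIM(real^'n) - 1"
    and sub: "e \<subseteq> frontier K" "e \<subseteq> K"
  shows "norm (outward_normal K e) = 1"
proof -
  obtain a b where a: "norm a = 1" "affine hull e = {z. a \<bullet> z = b}"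
    "\<And>y. y \<in> closure K \<Longrightarrow> a \<bullet> y \<le> b" "\<And>y. y \<in> interior K \<Longrightarrow> a \<bullet> y < b"
    using supporting_hyperplane_edge[OF e K sub(1)] by metis
  have ae: "a \<bullet> x = b" if "x \<in> e" for x using that hull_subset[of e affine] a(2) by auto
  have "e \<noteq> {}" using a(1,2) e(2) by (metis DIM_positive aff_dim_empty_eq diff_eq_eq
      add.left_inverse less_irrefl of_nat_0_eq_iff)
  then obtain x where x: "x \<in> rel_interior e" using rel_interior_eq_empty[OF e(1)] by auto
  then have xe: "x \<in> e" using rel_interior_subset by auto
  have "\<exists>!\<nu>. norm \<nu> = 1 \<and> (\<forall>x\<in>e. \<forall>y\<in>K. \<nu> \<bullet> (y - x) \<le> 0)"
  proof (rule ex1I[of _ a])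
    show "norm a = 1 \<and> (\<forall>x\<in>e. \<forall>y\<in>K. a \<bullet> (y - x) \<le> 0)"
      using a(1,3) ae closure_subset by (auto simp: inner_diff_right)
  next
    fix \<nu> assume \<nu>: "norm \<nu> = 1 \<and> (\<forall>x\<in>e. \<forall>y\<in>K. \<nu> \<bullet> (y - x) \<le> 0)"
    have hull: "affine hull e = {z. \<nu> \<bullet> z = \<nu> \<bullet> x}"
      using \<nu> xe sub(2) by (intro affine_hull_supporting[OF e x]) (auto simp: inner_diff_right)
    define s where "s = a \<bullet> \<nu>"
    define u where "u = \<nu> - s *\<^sub>R a"
    have au: "a \<bullet> u = 0" using a(1) by (simp add: u_def s_def inner_diff_right norm_eq_1)
    then have "x + u \<in> affine hull e" using ae[OF xe] by (simp add: a(2) inner_add_right)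
    then have "\<nu> \<bullet> u = 0" by (simp add: hull inner_add_right)
    then have "u \<bullet> u = 0" using au by (simp add: u_def inner_diff_left)
    then have \<nu>_eq: "\<nu> = s *\<^sub>R a" by (simp add: u_def)
    then have "\<bar>s\<bar> = 1" using \<nu> a(1) by simp
    moreover have "s \<noteq> - 1"
    proof
      assume "s = - 1"
      obtain y where y: "y \<in> interior K" using K(2) by blast
      then have "y \<in> K" using interior_subset by blast
      then have "\<nu> \<bullet> (y - x) \<le> 0" using \<nu> xe by blast
      then show False using \<nu>_eq \<open>s = - 1\<close> a(4)[OF y] ae[OF xe] by (simp add: inner_diff_right)
    qed
    ultimately have "s = 1" by linarith
    then show "\<nu> = a" using \<nu>_eq by simp
  qed
  from theI'[OF this] show ?thesis unfolding outward_normal_def by blast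
qed

subsection \<open>Coercivity\<close>

lemma edge_integral_cong:
  assumes "\<And>x. x \<in> e \<Longrightarrow> f x = g x"
  shows "edge_integral e f = edge_integral e g"
  unfolding edge_integral_def
  by (intro Henstock_Kurzweil_Integration.integral_cong) (auto simp: unit_prism_def assms)

lemma continuous_on_matrix_vector_mult:
  fixes S :: "'b::topological_space \<Rightarrow> real^'n^'m"
  assumes "continuous_on X S"
  shows "continuous_on X (\<lambda>x. S x *v \<nu>)"
  unfolding matrix_vector_mult_def
  by (intro continuous_on_vec_lambda continuous_intros continuous_on_sum)
    (auto intro!: continuous_intros assms)

lemma norm_matrix_vector_le:
  fixes A :: "real^'n^'m"
  shows "norm (A *v v) \<le> norm A * norm v"
proof -
  have "(norm (A *v v))\<^sup>2 = (\<Sum>i\<in>UNIV. (A $ i \<bullet> v)\<^sup>2)"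
    unfolding power2_norm_eq_inner inner_vec_def[of "A *v v"] matrix_vector_mul_component
    by (simp add: power2_eq_square)
  also have "\<dots> \<le> (\<Sum>i\<in>UNIV. (norm (A $ i))\<^sup>2 * (norm v)\<^sup>2)"
    by (intro sum_mono) (metis abs_le_square_iff Cauchy_Schwarz_ineq2 abs_mult abs_norm_cancel power_mult_distrib)
  also have "\<dots> = (norm A * norm v)\<^sup>2"
    by (simp add: power_mult_distrib sum_distrib_right power2_norm_eq_inner inner_vec_def)
  finally show ?thesis by (rule power2_le_imp_le) simp
qed

lemma power2_mean_le: "((x + y) / 2)\<^sup>2 \<le> x\<^sup>2 + y\<^sup>2" for x y :: real
proof -
  have "0 \<le> (1/2) * (x\<^sup>2 + y\<^sup>2) + ((x - y) / 2)\<^sup>2" by simp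
  also have "\<dots> = x\<^sup>2 + y\<^sup>2 - ((x + y) / 2)\<^sup>2" by (simp add: power2_eq_square field_simps)
  finally show ?thesis by simp
qed

lemma inner_le_Young:
  fixes u v :: "'a::real_inner"
  assumes "\<eta> > 0"
  shows "u \<bullet> v \<le> \<eta> / 2 * (norm u)\<^sup>2 + 1 / (2 * \<eta>) * (norm v)\<^sup>2"
proof -
  have "0 \<le> (norm (\<eta> *\<^sub>R u - v))\<^sup>2" by simp
  also have "\<dots> = \<eta>\<^sup>2 * (norm u)\<^sup>2 - 2 * \<eta> * (u \<bullet> v) + (norm v)\<^sup>2"
    unfolding power2_norm_eq_inner
    by (simp add: inner_diff_left inner_diff_right inner_commute power2_eq_square)
  finally show ?thesis using assms by (simp add: field_simps power2_eq_square)
qed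

section \<open>The consistency term on a single mesh\<close>

context
  fixes Om GD :: "(real^'n) set" and T :: "(real^'n) set set"
    and C :: "real^'n \<Rightarrow> 'n tensor4" and w :: "real^'n \<Rightarrow> real^'n" and r :: nat and B :: real
    and P :: "(real^'n) set \<Rightarrow> (real^'n) set"
  assumes dom: "polytopal_domain Om" and sub: "subdivision Om T"
    and const: "\<forall>K\<in>T. C constant_on interior K"
    and w: "w \<in> dg_space T r" and B: "B > 0"
    and bound: "\<And>K x M. K \<in> T \<Longrightarrow> x \<in> interior K \<Longrightarrow> transpose M = M \<Longrightarrow>
      (norm (tensor_apply (C x) M))\<^sup>2 \<le> B * (tensor_apply (C x) M \<bullet> M)"
    and P: "orientation T (dg_edges Om GD T) P"
begin

text \<open>The tensor is frozen at one interior point of each element, so that the stress extends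
  continuously to the closed element and keeps its pointwise bound by the energy density
  there.\<close>

lemma element_data:
  "\<exists>p S E. \<forall>K\<in>T. continuous_on UNIV (p K) \<and> continuous_on UNIV (S K) \<and> continuous_on UNIV (E K) \<and>
    (\<forall>i j. line_poly r (\<lambda>x. S K x $ i $ j)) \<and> (\<forall>x. (norm (S K x))\<^sup>2 \<le> B * (S K x \<bullet> E K x)) \<and>
    (\<forall>x\<in>interior K. w x = p K x \<and> stress C w x = S K x \<and> strain w x = E K x)"
proof -
  define Q where "Q K p S E \<longleftrightarrow> continuous_on UNIV p \<and> continuous_on UNIV S \<and> continuous_on UNIV E \<and>
    (\<forall>i j. line_poly r (\<lambda>x. S x $ i $ j)) \<and> (\<forall>x. (norm (S x))\<^sup>2 \<le> B * (S x \<bullet> E x)) \<and>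
    (\<forall>x\<in>interior K. w x = p x \<and> stress C w x = S x \<and> strain w x = E x)" for K p S E
  have "\<exists>p S E. Q K p S E" if K: "K \<in> T" for K
  proof -
    obtain p E where p: "continuous_on UNIV p" and E: "continuous_on UNIV E"
      and pE: "\<forall>x. transpose (E x) = E x" "\<forall>i j. line_poly r (\<lambda>x. E x $ i $ j)"
        "\<forall>x\<in>interior K. w x = p x \<and> strain w x = E x"
      using dg_space_element[OF w K] by blast
    obtain y where y: "y \<in> interior K" using subdivision_element(4)[OF dom sub K] by blast
    have "C constant_on interior K" using const K by blast
    then have Cy: "C x = C y" if "x \<in> interior K" for x
      using y that unfolding constant_on_def by metis
    define S where "S x = tensor_apply (C y) (E x)" for x
    have "continuous_on UNIV S"
      unfolding S_def using linear_tensor_apply[of "C y"] E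
      by (metis linear_continuous_on_compose)
    moreover have "line_poly r (\<lambda>x. S x $ i $ j)" for i j
      unfolding S_def tensor_apply_def vec_lambda_beta
      by (intro line_poly_sum line_poly_cmult pE(2)[rule_format])
    moreover have "(norm (S x))\<^sup>2 \<le> B * (S x \<bullet> E x)" for x
      unfolding S_def by (rule bound[OF K y pE(1)[rule_format]])
    moreover have "stress C w x = S x" if "x \<in> interior K" for x
      using Cy[OF that] pE(3) that by (simp add: stress_eq S_def)
    ultimately have "Q K p S E" using p E pE(3) by (auto simp: Q_def)
    then show ?thesis by blast
  qed
  then obtain p S E where "\<forall>K\<in>T. Q K (p K) (S K) (E K)" by metis
  then show ?thesis unfolding Q_def by blast
qed

text \<open>The density is nonnegative in the interior, being at least a squared norm divided by
  \<open>B\<close>. On the frontier, a null set, \<open>C\<close> and the strain are arbitrary, so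
  the integrand is replaced by 0 there.\<close>

lemma stress_energy_nonneg:
  assumes "K \<in> T"
  shows "0 \<le> integral K (\<lambda>x. stress C w x \<bullet> strain w x)"
proof -
  let ?f = "\<lambda>x. if x \<in> interior K then stress C w x \<bullet> strain w x else 0"
  have "0 \<le> integral K ?f"
  proof (rule integral_nonneg_gen)
    fix x
    have "0 \<le> B * (stress C w x \<bullet> strain w x)" if "x \<in> interior K"
      using order_trans[OF zero_le_power2 bound[OF assms that, of "strain w x"]]
      by (simp add: stress_eq strain_def transpose_def vec_eq_iff add.commute)
    then show "0 \<le> ?f x" using B by (simp add: zero_le_mult_iff)
  qed
  also have "integral K ?f = integral K (\<lambda>x. stress C w x \<bullet> strain w x)"
    using closure_subset[of K]
    by (intro integral_spike[OF negligible_convex_frontier[OF subdivision_element(2)[OF dom sub assms]]])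
      (auto simp: frontier_def)
  finally show ?thesis .
qed

text \<open>In the constant, 2 (1 + n) r^2 bounds (r + 1)(r + n) for r >= 1, \<open>B\<close>
  converts squared stress into energy, and \<rho> \<rho>' h is a lower bound for the radius of the
  inscribed balls. The weight \<eta> of Young's inequality stays free until the final
  balance.\<close>

lemma consistency_bound:
  assumes \<rho>: "\<rho> > 0" "\<And>K. K \<in> T \<Longrightarrow> \<exists>x. cball x (\<rho> * diameter K) \<subseteq> K"
    and \<rho>': "\<rho>' > 0" "\<And>K. K \<in> T \<Longrightarrow> \<rho>' * mesh_size T \<le> diameter K"
    and r: "r \<ge> 1" and \<eta>: "\<eta> > 0" and h: "mesh_size T > 0"
  shows "(\<Sum>e\<in>dg_edges Om GD T. edge_integral e (\<lambda>x.
      average T P e (\<lambda>y. stress C w y *v outward_normal (P e) e) x \<bullet> jump T P e w x))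
    \<le> \<eta> / 2 * (2 * (1 + CARD('n)) * B / (\<rho> * \<rho>') * (real r)\<^sup>2 / mesh_size T) *
        (\<Sum>K\<in>T. integral K (\<lambda>x. stress C w x \<bullet> strain w x))
      + 1 / (2 * \<eta>) * (\<Sum>e\<in>dg_edges Om GD T. edge_integral e (\<lambda>x. (norm (jump T P e w x))\<^sup>2))"
proof -
  define E where "E = dg_edges Om GD T"
  define h where "h = mesh_size T"
  obtain p S \<epsilon> where data: "\<forall>K\<in>T. continuous_on UNIV (p K) \<and> continuous_on UNIV (S K) \<and>
    continuous_on UNIV (\<epsilon> K) \<and> (\<forall>i j. line_poly r (\<lambda>x. S K x $ i $ j)) \<and>
    (\<forall>x. (norm (S K x))\<^sup>2 \<le> B * (S K x \<bullet> \<epsilon> K x)) \<and>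
    (\<forall>x\<in>interior K. w x = p K x \<and> stress C w x = S K x \<and> strain w x = \<epsilon> K x)"
    using element_data by blast
  have d: "continuous_on UNIV (p K)" "continuous_on UNIV (S K)" "continuous_on UNIV (\<epsilon> K)"
    "line_poly r (\<lambda>x. S K x $ i $ j)" "(norm (S K x))\<^sup>2 \<le> B * (S K x \<bullet> \<epsilon> K x)"
    "x \<in> interior K \<Longrightarrow> w x = p K x" "x \<in> interior K \<Longrightarrow> stress C w x = S K x"
    "x \<in> interior K \<Longrightarrow> strain w x = \<epsilon> K x" if "K \<in> T" for K x i j
    using data that by blast+
  define adj where "adj e = {K \<in> T. e \<subseteq> frontier K}" for e
  define g where "g K x = (norm (S K x))\<^sup>2" for K x
  have finT: "finite T" and finE: "finite E"
    using sub finite_edges[OF dom sub] by (auto simp: subdivision_def E_def)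
  have contg: "continuous_on X (g K)" if "K \<in> T" for K X
    unfolding g_def by (intro continuous_intros continuous_on_subset[OF d(2)[OF that]]) simp
  have facet: "edge_integral e (\<lambda>x.
        average T P e (\<lambda>y. stress C w y *v outward_normal (P e) e) x \<bullet> jump T P e w x)
      \<le> \<eta> / 2 * (\<Sum>K\<in>adj e. edge_integral e (g K))
        + 1 / (2 * \<eta>) * edge_integral e (\<lambda>x. (norm (jump T P e w x))\<^sup>2)" if e: "e \<in> E" for e
  proof -
    define \<nu> where "\<nu> = outward_normal (P e) e"
    note ed = dg_edge[OF dom sub e[unfolded E_def]]
    have Pe: "P e \<in> T" "e \<subseteq> frontier (P e)"
      using P e by (auto simp: orientation_def E_def)
    have sub_el: "e \<subseteq> K" if "K \<in> adj e" for K
      using that subdivision_element(3)[OF dom sub, of K] frontier_subset_closed by (auto simp: adj_def)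
    have \<nu>: "norm \<nu> = 1"
      unfolding \<nu>_def
      by (rule norm_outward_normal[OF subdivision_element(2,4)[OF dom sub Pe(1)] ed(2,3) Pe(2) sub_el])
        (simp add: adj_def Pe)
    have tr: "element_trace K (\<lambda>y. stress C w y *v \<nu>) x = S K x *v \<nu>"
        "element_trace K w x = p K x" if "K \<in> adj e" "x \<in> e" for K x
    proof -
      have K: "K \<in> T" "x \<in> K" using that sub_el[OF that(1)] by (auto simp: adj_def)
      show "element_trace K (\<lambda>y. stress C w y *v \<nu>) x = S K x *v \<nu>"
        by (rule element_trace_eq[OF subdivision_element(2,4)[OF dom sub K(1)] K(2)
              continuous_on_matrix_vector_mult[OF d(2)[OF K(1)]]]) (simp add: d(7)[OF K(1)])
      show "element_trace K w x = p K x"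
        by (rule element_trace_eq[OF subdivision_element(2,4)[OF dom sub K(1)] K(2) d(1,6)[OF K(1)]])
    qed
    have adjP: "P e \<in> adj e" using Pe by (simp add: adj_def)
    have adjO: "opposite T P e \<in> adj e \<and> opposite T P e \<noteq> P e" if "e \<in> interior_edges T"
      using opposite_element[where P = P, OF dom sub that Pe] by (simp add: adj_def)
    have Sn: "norm (S K x *v \<nu>) \<le> norm (S K x)" for K x
      using norm_matrix_vector_le[of "S K x" \<nu>] \<nu> by simp
    have gn: "(norm (S K x *v \<nu>))\<^sup>2 \<le> g K x" for K x
      using Sn[of K x] by (simp add: g_def power_mono)
    have finadj: "finite (adj e)" using finT by (simp add: adj_def)
    \<comment> \<open>Continuous representatives of average and jump. Bounding the average by the
      sum over all adjacent elements treats the single trace of a boundary edge and the mean of two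
      traces alike.\<close>
    obtain A J where A: "continuous_on e A" "\<And>x. (norm (A x))\<^sup>2 \<le> (\<Sum>K\<in>adj e. g K x)"
      "\<And>x. x \<in> e \<Longrightarrow> average T P e (\<lambda>y. stress C w y *v \<nu>) x = A x"
      and J: "continuous_on e J" "\<And>x. x \<in> e \<Longrightarrow> jump T P e w x = (J x :: real^'n)"
    proof (cases "e \<in> interior_edges T")
      case False
      show thesis
      proof (rule that[of "\<lambda>x. S (P e) x *v \<nu>" "p (P e)"])
        show "(norm (S (P e) x *v \<nu>))\<^sup>2 \<le> (\<Sum>K\<in>adj e. g K x)" for x
          by (rule order_trans[OF gn member_le_sum[OF adjP _ finadj]]) (simp add: g_def)
        show "continuous_on e (\<lambda>x. S (P e) x *v \<nu>)" "continuous_on e (p (P e))"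
          using d(1,2)[OF Pe(1)] by (auto intro: continuous_on_matrix_vector_mult continuous_on_subset)
      qed (use False tr[OF adjP] in \<open>auto simp: average_def jump_def\<close>)
    next
      case True
      define Q where "Q = opposite T P e"
      have Q: "Q \<in> adj e" "Q \<noteq> P e" "Q \<in> T" using adjO[OF True] by (auto simp: Q_def adj_def)
      show thesis
      proof (rule that[of "\<lambda>x. (1/2) *\<^sub>R (S (P e) x *v \<nu> + S Q x *v \<nu>)" "\<lambda>x. p (P e) x - p Q x"])
        show "(norm ((1/2) *\<^sub>R (S (P e) x *v \<nu> + S Q x *v \<nu>)))\<^sup>2 \<le> (\<Sum>K\<in>adj e. g K x)" for x
        proof -
          let ?a = "norm (S (P e) x *v \<nu>)" and ?b = "norm (S Q x *v \<nu>)"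
          have "norm ((1/2) *\<^sub>R (S (P e) x *v \<nu> + S Q x *v \<nu>)) \<le> (?a + ?b) / 2"
            using norm_triangle_ineq[of "S (P e) x *v \<nu>" "S Q x *v \<nu>"] by simp
          then have "(norm ((1/2) *\<^sub>R (S (P e) x *v \<nu> + S Q x *v \<nu>)))\<^sup>2 \<le> ((?a + ?b) / 2)\<^sup>2"
            by (rule power_mono) simp
          also have "\<dots> \<le> ?a\<^sup>2 + ?b\<^sup>2" by (rule power2_mean_le)
          also have "\<dots> \<le> g (P e) x + g Q x" using gn by (intro add_mono) auto
          also have "\<dots> = (\<Sum>K\<in>{P e, Q}. g K x)" using Q by simp
          also have "\<dots> \<le> (\<Sum>K\<in>adj e. g K x)"
            using finadj adjP Q by (intro sum_mono2) (auto simp: g_def)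
          finally show ?thesis .
        qed
        show "continuous_on e (\<lambda>x. (1/2) *\<^sub>R (S (P e) x *v \<nu> + S Q x *v \<nu>))"
          "continuous_on e (\<lambda>x. p (P e) x - p Q x)"
          using d(1,2)[OF Pe(1)] d(1,2)[OF Q(3)]
          by (auto intro!: continuous_intros continuous_on_matrix_vector_mult intro: continuous_on_subset)
      qed (use True tr[OF adjP] tr[OF Q(1)] in \<open>auto simp: average_def jump_def Q_def\<close>)
    qed
    obtain a b where ab: "norm a = 1" "affine hull e = {z. a \<bullet> z = b}"
      using supporting_hyperplane_edge[OF ed(2,3) subdivision_element(2,4)[OF dom sub Pe(1)] Pe(2)] by metis
    let ?c = "closest_point (affine hull e)"
    have int: "(\<lambda>y. f (?c y)) integrable_on unit_prism e" if "continuous_on e f" for f :: "_ \<Rightarrow> real"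
      using edge_integral_hyperplane(1)[OF ed(1,2) ab(2,1) that] .
    have intg: "(\<lambda>y. g K (?c y)) integrable_on unit_prism e" if "K \<in> adj e" for K
      using that by (intro int contg) (auto simp: adj_def)
    have intJ: "(\<lambda>y. (norm (J (?c y)))\<^sup>2) integrable_on unit_prism e"
      by (rule int[of "\<lambda>y. (norm (J y))\<^sup>2"]) (intro continuous_intros J)
    have "edge_integral e (\<lambda>x. average T P e (\<lambda>y. stress C w y *v \<nu>) x \<bullet> jump T P e w x)
        = edge_integral e (\<lambda>x. A x \<bullet> J x)"
      by (intro edge_integral_cong) (simp add: A J)
    also have "\<dots> \<le> integral (unit_prism e)
        (\<lambda>y. \<eta> / 2 * (\<Sum>K\<in>adj e. g K (?c y)) + 1 / (2 * \<eta>) * (norm (J (?c y)))\<^sup>2)"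
      unfolding edge_integral_def
    proof (rule integral_le)
      show "(\<lambda>y. A (?c y) \<bullet> J (?c y)) integrable_on unit_prism e"
        by (rule int[of "\<lambda>y. A y \<bullet> J y"]) (intro continuous_intros A J)
      show "(\<lambda>y. \<eta> / 2 * (\<Sum>K\<in>adj e. g K (?c y)) + 1 / (2 * \<eta>) * (norm (J (?c y)))\<^sup>2)
          integrable_on unit_prism e"
        by (intro integrable_add integrable_on_mult_right integrable_sum intJ intg finadj)
      fix y
      have "A (?c y) \<bullet> J (?c y) \<le> \<eta> / 2 * (norm (A (?c y)))\<^sup>2 + 1 / (2 * \<eta>) * (norm (J (?c y)))\<^sup>2"
        by (rule inner_le_Young[OF \<eta>])
      then show "A (?c y) \<bullet> J (?c y) \<le> \<eta> / 2 * (\<Sum>K\<in>adj e. g K (?c y)) + 1 / (2 * \<eta>) * (norm (J (?c y)))\<^sup>2"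
        using mult_left_mono[OF A(2)[of "?c y"], of "\<eta> / 2"] \<eta> by linarith
    qed
    also have "\<dots> = \<eta> / 2 * (\<Sum>K\<in>adj e. edge_integral e (g K))
        + 1 / (2 * \<eta>) * edge_integral e (\<lambda>x. (norm (J x))\<^sup>2)"
      unfolding edge_integral_def
      by (subst integral_add[OF integrable_on_mult_right[OF integrable_sum[OF finadj intg]]
            integrable_on_mult_right[OF intJ]])
        (simp_all add: integral_sum[OF finadj intg])
    also have "edge_integral e (\<lambda>x. (norm (J x))\<^sup>2) = edge_integral e (\<lambda>x. (norm (jump T P e w x))\<^sup>2)"
      by (intro edge_integral_cong) (simp add: J)
    finally show ?thesis unfolding \<nu>_def .
  qed
  define L where "L = 2 * (1 + CARD('n)) / (\<rho> * \<rho>') * (real r)\<^sup>2 / h"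
  have vol: "(\<Sum>e | e \<in> E \<and> e \<subseteq> frontier K. edge_integral e (g K))
      \<le> L * (B * integral K (\<lambda>x. stress C w x \<bullet> strain w x))" if K: "K \<in> T" for K
  proof -
    let ?M = "real ((r + 1) * (r + CARD('n)))"
    obtain x0 where x0: "cball x0 (\<rho> * diameter K) \<subseteq> K" using \<rho>(2)[OF K] by blast
    have diam: "0 < \<rho>' * h" "\<rho>' * h \<le> diameter K" using \<rho>' K h by (auto simp: h_def)
    have Ig: "g K integrable_on K" "(\<lambda>x. B * (S K x \<bullet> \<epsilon> K x)) integrable_on K"
      using subdivision_element(1)[OF dom sub K] d(2,3)[OF K]
      by (auto intro!: nn_integral_compact(1) contg K continuous_intros intro: continuous_on_subset)
    have "(\<Sum>e | e \<in> E \<and> e \<subseteq> frontier K. edge_integral e (g K)) \<le> ?M / (\<rho> * diameter K) * integral K (g K)"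
      unfolding E_def
    proof (rule trace_inequality[OF dom sub K x0])
      show "0 < \<rho> * diameter K" using \<rho>(1) diam by simp
      show "ennreal (g K z) \<le> ennreal ?M * (\<integral>\<^sup>+t. indicator {0<..<1} t *
          ennreal (t ^ (CARD('n) - 1) * g K (x0 + t *\<^sub>R (z - x0))) \<partial>lborel)" for z
        unfolding g_def by (rule line_poly_ray_bound[OF d(4)[OF K]]) (simp add: Suc_leI)
    qed (simp_all add: contg[OF K, unfolded g_def] g_def)
    also have "\<dots> \<le> L * integral K (g K)"
    proof (rule mult_right_mono)
      have "?M \<le> (2 * real r) * ((1 + CARD('n)) * real r)"
      proof -
        have "r + 1 \<le> 2 * r" "r + CARD('n) \<le> (1 + CARD('n)) * r" using r by auto
        then have "(r + 1) * (r + CARD('n)) \<le> (2 * r) * ((1 + CARD('n)) * r)" by (rule mult_le_mono)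
        then have "?M \<le> real ((2 * r) * ((1 + CARD('n)) * r))" by (simp only: of_nat_le_iff)
        then show ?thesis by (simp add: algebra_simps)
      qed
      then have "?M / (\<rho> * diameter K) \<le> (2 * real r) * ((1 + CARD('n)) * real r) / (\<rho> * (\<rho>' * h))"
        using diam \<rho>(1) by (intro frac_le mult_left_mono) auto
      also have "\<dots> = L" by (simp add: L_def power2_eq_square algebra_simps)
      finally show "?M / (\<rho> * diameter K) \<le> L" .
      show "0 \<le> integral K (g K)"
        using Ig(1) by (rule Henstock_Kurzweil_Integration.integral_nonneg) (simp add: g_def)
    qed
    also have "\<dots> \<le> L * (B * integral K (\<lambda>x. stress C w x \<bullet> strain w x))"
    proof (rule mult_left_mono)
      have "integral K (g K) \<le> integral K (\<lambda>x. B * (S K x \<bullet> \<epsilon> K x))"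
        using d(5)[OF K] by (intro integral_le Ig) (simp add: g_def)
      also have "\<dots> = B * integral K (\<lambda>x. S K x \<bullet> \<epsilon> K x)" by simp
      also have "integral K (\<lambda>x. S K x \<bullet> \<epsilon> K x) = integral K (\<lambda>x. stress C w x \<bullet> strain w x)"
        using d(7,8)[OF K] closure_subset[of K]
        by (intro integral_spike[OF negligible_convex_frontier[OF subdivision_element(2)[OF dom sub K]]])
          (auto simp: frontier_def)
      finally show "integral K (g K) \<le> B * integral K (\<lambda>x. stress C w x \<bullet> strain w x)" .
      show "0 \<le> L" using \<rho>(1) \<rho>'(1) h by (simp add: L_def h_def)
    qed
    finally show ?thesis .
  qed
  have "(\<Sum>e\<in>E. edge_integral e (\<lambda>x.
      average T P e (\<lambda>y. stress C w y *v outward_normal (P e) e) x \<bullet> jump T P e w x))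
    \<le> (\<Sum>e\<in>E. \<eta> / 2 * (\<Sum>K\<in>adj e. edge_integral e (g K))
        + 1 / (2 * \<eta>) * edge_integral e (\<lambda>x. (norm (jump T P e w x))\<^sup>2))"
    by (intro sum_mono facet)
  also have "\<dots> = \<eta> / 2 * (\<Sum>e\<in>E. \<Sum>K\<in>adj e. edge_integral e (g K))
      + 1 / (2 * \<eta>) * (\<Sum>e\<in>E. edge_integral e (\<lambda>x. (norm (jump T P e w x))\<^sup>2))"
    by (simp only: sum.distrib sum_distrib_left)
  \<comment> \<open>Double counting of pairs of an edge and an adjacent element: regrouped by
    elements, the inner sum is the one that the trace inequality controls.\<close>
  also have "(\<Sum>e\<in>E. \<Sum>K\<in>adj e. edge_integral e (g K))
      = (\<Sum>K\<in>T. \<Sum>e | e \<in> E \<and> e \<subseteq> frontier K. edge_integral e (g K))"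
    unfolding adj_def by (rule sum.swap_restrict[OF finE finT])
  also have "\<eta> / 2 * \<dots> \<le> \<eta> / 2 * (\<Sum>K\<in>T. L * (B * integral K (\<lambda>x. stress C w x \<bullet> strain w x)))"
    using \<eta> by (intro mult_left_mono sum_mono vol) auto
  also have "(\<Sum>K\<in>T. L * (B * integral K (\<lambda>x. stress C w x \<bullet> strain w x)))
      = 2 * (1 + CARD('n)) * B / (\<rho> * \<rho>') * (real r)\<^sup>2 / h *
        (\<Sum>K\<in>T. integral K (\<lambda>x. stress C w x \<bullet> strain w x))"
    by (simp add: L_def sum_distrib_left sum_divide_distrib mult_ac)
  finally show ?thesis by (simp add: E_def h_def mult.assoc)
qed

end

theorem lemma3p2:
  fixes Om GD GN :: "(real^'n) set"
    and C :: "real^'n \<Rightarrow> 'n tensor4"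
    and F :: "(real^'n) set set set"
    and \<alpha> :: real
  assumes "CARD('n) = 2 \<or> CARD('n) = 3"
    and "polytopal_domain Om"
    and "frontier Om = GD \<union> GN"
    and "\<forall>x\<in>Om. elasticity_tensor (C x)"
    and "\<forall>T\<in>F. subdivision Om T"
    and "\<forall>T\<in>F. \<forall>K\<in>T. C constant_on interior K"
    and "nondegenerate_family F"
    and "quasiuniform_family F"
    and "\<alpha> \<in> {-1, 0, 1}"
  shows "\<exists>\<beta>\<^sub>0\<ge>0. (\<alpha> = 1 \<longrightarrow> \<beta>\<^sub>0 = 0) \<and>
           (\<forall>\<beta> \<gamma>. \<beta> > \<beta>\<^sub>0 \<and> \<gamma> \<ge> 0 \<longrightarrow>
             (\<exists>Cs>0. \<forall>T\<in>F. \<forall>P. orientation T (dg_edges Om GD T) P \<longrightarrow>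
                (\<forall>r\<ge>1. \<forall>w\<in>dg_space T r.
                   Bh Om GD C \<alpha> \<beta> \<gamma> T P r w w
                     \<ge> Cs * (energy_norm Om GD C \<beta> \<gamma> T P r w)\<^sup>2)))"
proof -
  obtain B where B: "B > 0" "\<And>T K x M. T \<in> F \<Longrightarrow> K \<in> T \<Longrightarrow> x \<in> interior K \<Longrightarrow> transpose M = M \<Longrightarrow>
    (norm (tensor_apply (C x) M))\<^sup>2 \<le> B * (tensor_apply (C x) M \<bullet> M)"
    using tensor_field_bound[OF assms(2,4,5,6)] by metis
  obtain \<rho> where \<rho>: "\<rho> > 0" "\<And>T K. T \<in> F \<Longrightarrow> K \<in> T \<Longrightarrow> \<exists>x. cball x (\<rho> * diameter K) \<subseteq> K"
    using assms(7) unfolding nondegenerate_family_def by blast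
  obtain \<rho>' where \<rho>': "\<rho>' > 0" "\<And>T K. T \<in> F \<Longrightarrow> K \<in> T \<Longrightarrow> \<rho>' * mesh_size T \<le> diameter K"
    using assms(8) unfolding quasiuniform_family_def by blast
  define L where "L = 2 * (1 + CARD('n)) * B / (\<rho> * \<rho>')"
  have L: "L > 0" using B(1) \<rho>(1) \<rho>'(1) by (simp add: L_def)
  \<comment> \<open>Young's inequality will leave \<open>L * q\<close> in front of the jumps, and
    the consistency term enters with the factor 1 - \<alpha>, at most 2.\<close>
  define \<beta>0 where "\<beta>0 = (if \<alpha> = 1 then 0 else 2 * L)"
  have main: "\<exists>Cs>0. \<forall>T\<in>F. \<forall>P. orientation T (dg_edges Om GD T) P \<longrightarrow>
                (\<forall>r\<ge>1. \<forall>w\<in>dg_space T r.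
                   Bh Om GD C \<alpha> \<beta> \<gamma> T P r w w
                     \<ge> Cs * (energy_norm Om GD C \<beta> \<gamma> T P r w)\<^sup>2)"
    if \<beta>: "\<beta> > \<beta>0" and \<gamma>: "\<gamma> \<ge> 0" for \<beta> \<gamma>
  proof -
    have \<beta>_pos: "\<beta> > 0" using \<beta> L by (simp add: \<beta>0_def split: if_splits)
    \<comment> \<open>One half is the share of the volume energy that survives the absorption, and 1
      - 2 L / \<beta> that of the jump penalty; the \<gamma> term is kept whole.\<close>
    define Cs where "Cs = (if \<alpha> = 1 then 1 else min (1/2) (1 - 2 * L / \<beta>))"
    have Cs: "Cs > 0" using \<beta> \<beta>_pos by (auto simp: Cs_def \<beta>0_def split: if_splits)
    have "Cs * (energy_norm Om GD C \<beta> \<gamma> T P r w)\<^sup>2 \<le> Bh Om GD C \<alpha> \<beta> \<gamma> T P r w w"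
      if T: "T \<in> F" and P: "orientation T (dg_edges Om GD T) P" and r: "r \<ge> 1" and w: "w \<in> dg_space T r"
      for T P r w
    proof -
      note sub = assms(5)[rule_format, OF T]
      define h where "h = mesh_size T"
      define q where "q = (real r)\<^sup>2 / h"
      let ?E = "dg_edges Om GD T"
      define A where "A = (\<Sum>K\<in>T. integral K (\<lambda>x. stress C w x \<bullet> strain w x))"
      define X where "X = (\<Sum>e\<in>?E. edge_integral e (\<lambda>x.
        average T P e (\<lambda>y. stress C w y *v outward_normal (P e) e) x \<bullet> jump T P e w x))"
      define J where "J = (\<Sum>e\<in>?E. edge_integral e (\<lambda>x. (norm (jump T P e w x))\<^sup>2))"
      define N where "N = (\<Sum>e\<in>?E. edge_integral e (\<lambda>x. (norm (jump T P e (\<lambda>y. outward_normal (P e) e \<bullet> w y) x))\<^sup>2))"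
      have h: "h > 0"
      proof -
        have "closure Om \<noteq> {}" using assms(2) by (simp add: polytopal_domain_def)
        then have "T \<noteq> {}" using sub unfolding subdivision_def by (metis Union_empty)
        then obtain K where K: "K \<in> T" by blast
        obtain x \<epsilon> where x: "\<epsilon> > 0" "cball x \<epsilon> \<subseteq> K"
          using subdivision_element(4)[OF assms(2) sub K] by (auto simp: mem_interior_cball)
        have "0 < diameter (cball x \<epsilon>)" using x by simp
        also have "\<dots> \<le> diameter K"
          using x subdivision_element(1)[OF assms(2) sub K] by (intro diameter_subset) (auto simp: compact_imp_bounded)
        also have "\<dots> \<le> h"
          using K sub unfolding h_def mesh_size_def by (intro Max_ge) (auto simp: subdivision_def)
        finally show ?thesis .
      qed
      have q: "q > 0" using r h by (simp add: q_def)
      have A: "A \<ge> 0" unfolding A_def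
        by (intro sum_nonneg
            stress_energy_nonneg[OF assms(2) sub bspec[OF assms(6) T] w B(1) B(2)[OF T] P])
      have J: "J \<ge> 0" and N: "N \<ge> 0"
        unfolding J_def N_def by (intro sum_nonneg edge_integral_nonneg; simp)+
      have Bh: "Bh Om GD C \<alpha> \<beta> \<gamma> T P r w w = A - (1 - \<alpha>) * X + \<beta> * q * J + \<gamma> * q * N"
        unfolding Bh_def Let_def A_def X_def J_def N_def q_def h_def
        by (simp add: left_diff_distrib flip: power2_norm_eq_inner power2_eq_square)
      have "energy_norm Om GD C \<beta> \<gamma> T P r w = sqrt (A + \<beta> * q * J + \<gamma> * q * N)"
        unfolding energy_norm_def Let_def A_def J_def N_def q_def h_def by simp
      then have norm: "(energy_norm Om GD C \<beta> \<gamma> T P r w)\<^sup>2 = A + \<beta> * q * J + \<gamma> * q * N"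
        using A J N q \<beta>_pos \<gamma> by simp
      show ?thesis
      proof (cases "\<alpha> = 1")
        case True
        then show ?thesis unfolding Bh norm by (simp add: Cs_def)
      next
        case False
        then have \<alpha>: "0 \<le> 1 - \<alpha>" "1 - \<alpha> \<le> 2" using assms(9) by auto
        \<comment> \<open>Gives the energy the coefficient 1/4, hence at most 1/2 after
          multiplication by 1 - \<alpha>, and the jumps the coefficient
          \<open>L * q\<close>.\<close>
        define \<eta> where "\<eta> = 1 / (2 * L * q)"
        have \<eta>: "\<eta> > 0" using L q by (simp add: \<eta>_def)
        have "X \<le> \<eta> / 2 * (L * q) * A + 1 / (2 * \<eta>) * J"
          using consistency_bound[OF assms(2) sub bspec[OF assms(6) T] w B(1) B(2)[OF T] P \<rho>(1) \<rho>(2)[OF T]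
              \<rho>'(1) \<rho>'(2)[OF T] r \<eta>] h
          unfolding X_def A_def J_def L_def q_def h_def by simp
        also have "\<dots> = A / 4 + L * q * J" using L q by (simp add: \<eta>_def)
        finally have "(1 - \<alpha>) * X \<le> (1 - \<alpha>) * (A / 4 + L * q * J)" using \<alpha> by (intro mult_left_mono)
        also have "\<dots> \<le> 2 * (A / 4 + L * q * J)"
          using \<alpha> A J L q by (intro mult_right_mono) auto
        finally have "A / 2 + (\<beta> - 2 * L) * q * J + \<gamma> * q * N \<le> Bh Om GD C \<alpha> \<beta> \<gamma> T P r w w"
          unfolding Bh by (simp add: algebra_simps)
        moreover have "Cs * A \<le> A / 2" "Cs * (\<gamma> * q * N) \<le> 1 * (\<gamma> * q * N)"
        proof -
          have "Cs \<le> 1/2" unfolding Cs_def using False by (simp only: if_False min.cobounded1)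
          then show "Cs * A \<le> A / 2" using mult_right_mono[of Cs "1/2" A] A by simp
          show "Cs * (\<gamma> * q * N) \<le> 1 * (\<gamma> * q * N)"
            using \<open>Cs \<le> 1/2\<close> N q \<gamma> by (intro mult_right_mono) auto
        qed
        moreover have "Cs * (\<beta> * q * J) \<le> (\<beta> - 2 * L) * q * J"
        proof -
          have "Cs * \<beta> \<le> (1 - 2 * L / \<beta>) * \<beta>"
            using False \<beta>_pos by (intro mult_right_mono) (auto simp: Cs_def)
          also have "\<dots> = \<beta> - 2 * L" using \<beta>_pos by (simp add: field_simps)
          finally have "Cs * \<beta> * (q * J) \<le> (\<beta> - 2 * L) * (q * J)"
            using q J by (intro mult_right_mono) auto
          then show ?thesis by (simp add: mult_ac)
        qed
        ultimately show ?thesis unfolding norm by (simp add: distrib_left)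
      qed
    qed
    with Cs show ?thesis by blast
  qed
  have "\<beta>0 \<ge> 0" "\<alpha> = 1 \<longrightarrow> \<beta>0 = 0" using L by (auto simp: \<beta>0_def)
  with main show ?thesis by blast
qed

end
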